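(* If $0\le\gamma\le\frac12$, then every $\mathrm{ECD}(\bar\theta)$ in $\mathcal D(v,r;k_1,k_2)$ is type-1-optimal and E-optimal over $\mathcal D(v,r;k_1,k_2)$.
   Context: Let $k_1\ge k_2\ge 2$ be integers, $v=k_1+k_2$, and $2\le r\le v-1$. A resolvable design $d$ consists of $r$ replicates, each replicate being a partition of a fixed set of $v$ treatments into two blocks, one of size $k_1$ and one of size $k_2$ (if $k_1=k_2$, one block of each replicate is designated as "the block of size $k_1$"). Let $N_d$ be the $v\times 2r$ zero-one treatment/block incidence matrix, $D_s=\mathrm{Diag}(k_1,k_2,k_1,k_2,\dots,k_1,k_2)$ the diagonal matrix of block sizes, and $C_d=rI-N_dD_s^{-1}N_d'$ the information matrix. The design is connected if $C_d$ has rank $v-1$; only connected designs are considered, and $\mathcal D=\mathcal D(v,r;k_1,k_2)$ denotes the class of all of them. The nonzero eigenvalues of $C_d$ are $z_{d1}\le z_{d2}\le\dots\le z_{d,v-1}$. For $h\ne h'$, $\phi_{dhh'}$ is the number of treatments common to the blocks of size $k_1$ in replicates $h$ and $h'$. A design $d$ is an equal concurrence design $\mathrm{ECD}(\theta)$ if $\phi_{dhh'}=\theta$ for all $h\neq h'$. Put $\bar\theta=\lfloor k_1^2/(k_1+k_2)\rfloor$ and $\gamma=k_1^2/(k_1+k_2)-\bar\theta\in[0,1)$. A type-1 criterion is $\psi_f(d)=\sum_{i=1}^{v-1}f(z_{di})$ where $f$ is continuously differentiable on $(0,\max_{d\in\mathcal D}\mathrm{tr}(C_d))$ with $f'<0$,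 $f''>0$, $f'''<0$ there, and $\lim_{x\to0^+}f(x)=\infty$. A design is type-1-optimal if it minimizes every type-1 criterion over $\mathcal D$. A design is E-optimal if it maximizes $z_{d1}$ over $\mathcal D$. *)

theory Defs
  imports
    Complex_Main
    "HOL-Computational_Algebra.Polynomial"
    "Jordan_Normal_Form.Char_Poly"
    "Jordan_Normal_Form.DL_Rank"
    "Jordan_Normal_Form.Gauss_Jordan_Elimination"
begin

text \<open>
  Treatments are labelled \<open>0, \<dots>, v - 1\<close>. A design is the list of its replicates; a replicate is
  the ordered pair consisting of its block of size \<open>k1\<close> and its block of size \<open>k2\<close>, so for
  \<open>k1 = k2\<close> the first component is the block designated as the one of size \<open>k1\<close>.
  Replicates may coincide.
\<close>

type_synonym design = "(nat set \<times> nat set) list"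

definition resolvable_design :: "nat \<Rightarrow> nat \<Rightarrow> nat \<Rightarrow> nat \<Rightarrow> design \<Rightarrow> bool" where
  "resolvable_design v r k1 k2 d \<longleftrightarrow>
     length d = r \<and>
     (\<forall>(A, B) \<in> set d. A \<union> B = {0..<v} \<and> A \<inter> B = {} \<and> card A = k1 \<and> card B = k2)"

text \<open>
  Blocks are numbered from \<open>0\<close> in the order \<open>k1, k2, k1, k2, \<dots>\<close>: the blocks of replicate \<open>h\<close> are
  number \<open>2 * h\<close> and number \<open>2 * h + 1\<close>.
\<close>

definition block :: "design \<Rightarrow> nat \<Rightarrow> nat set" where
  "block d j = (if even j then fst (d ! (j div 2)) else snd (d ! (j div 2)))"

definition incidence_matrix :: "nat \<Rightarrow> design \<Rightarrow> real mat" where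
  "incidence_matrix v d =
     mat v (2 * length d) (\<lambda>(i, j). if i \<in> block d j then 1 else 0)"

definition block_size_matrix :: "nat \<Rightarrow> nat \<Rightarrow> nat \<Rightarrow> real mat" where
  "block_size_matrix r k1 k2 = mat_diag (2 * r) (\<lambda>j. if even j then real k1 else real k2)"

definition information_matrix :: "nat \<Rightarrow> nat \<Rightarrow> nat \<Rightarrow> design \<Rightarrow> real mat" where
  "information_matrix v k1 k2 d =
     real (length d) \<cdot>\<^sub>m 1\<^sub>m v
     - incidence_matrix v d * the (mat_inverse (block_size_matrix (length d) k1 k2))
       * transpose_mat (incidence_matrix v d)"

lemma block_size_matrix_inverse:
  assumes "k1 > 0" "k2 > 0"
  shows "the (mat_inverse (block_size_matrix r k1 k2)) =
    mat_diag (2 * r) (\<lambda>j. if even j then 1 / real k1 else 1 / real k2)"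
proof -
  let ?n = "2 * r"
  let ?D = "block_size_matrix r k1 k2"
  let ?E = "mat_diag ?n (\<lambda>j. if even j then 1 / real k1 else 1 / real k2) :: real mat"
  have D: "?D \<in> carrier_mat ?n ?n" and E: "?E \<in> carrier_mat ?n ?n"
    by (simp_all add: block_size_matrix_def)
  have one: "mat_diag ?n (\<lambda>j. 1) = (1\<^sub>m ?n :: real mat)"
    by (rule eq_matI) (auto simp: mat_diag_def)
  have ED: "?E * ?D = 1\<^sub>m ?n" and DE: "?D * ?E = 1\<^sub>m ?n"
    using assms by (simp_all add: block_size_matrix_def if_distrib one cong: if_cong)
  have "?D \<in> Units (ring_mat TYPE(real) ?n ())"
    unfolding Units_def using D E ED DE by (auto simp: ring_mat_def)
  with mat_inverse(1)[OF D] obtain B where B: "mat_inverse ?D = Some B"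
    by fastforce
  from mat_inverse(2)[OF D B] have DB: "?D * B = 1\<^sub>m ?n" and Bc: "B \<in> carrier_mat ?n ?n"
    by auto
  have "B = (?E * ?D) * B" using ED Bc by simp
  also have "\<dots> = ?E" using assoc_mult_mat[OF E D Bc] DB E by simp
  finally show ?thesis using B by simp
qed

definition connected_design :: "nat \<Rightarrow> nat \<Rightarrow> nat \<Rightarrow> design \<Rightarrow> bool" where
  "connected_design v k1 k2 d \<longleftrightarrow> vec_space.rank v (information_matrix v k1 k2 d) = v - 1"

definition design_class :: "nat \<Rightarrow> nat \<Rightarrow> nat \<Rightarrow> nat \<Rightarrow> design set" where
  "design_class v r k1 k2 =
     {d. resolvable_design v r k1 k2 d \<and> connected_design v k1 k2 d}"

text \<open>
  The information matrix is real symmetric, so its eigenvalues with multiplicity are the real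
  roots of its characteristic polynomial. \<open>eigval v k1 k2 d i\<close> is the \<open>i\<close>-th smallest nonzero one,
  counted from \<open>1\<close>; for a connected design it is meaningful for \<open>i \<in> {1..v - 1}\<close>.
\<close>

definition nonzero_eigvals :: "nat \<Rightarrow> nat \<Rightarrow> nat \<Rightarrow> design \<Rightarrow> real list" where
  "nonzero_eigvals v k1 k2 d =
     sorted_list_of_multiset
       (filter_mset (\<lambda>x. x \<noteq> 0) (proots (char_poly (information_matrix v k1 k2 d))))"

definition eigval :: "nat \<Rightarrow> nat \<Rightarrow> nat \<Rightarrow> design \<Rightarrow> nat \<Rightarrow> real" where
  "eigval v k1 k2 d i = nonzero_eigvals v k1 k2 d ! (i - 1)"

definition concurrence :: "design \<Rightarrow> nat \<Rightarrow> nat \<Rightarrow> nat" where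
  "concurrence d h h' = card (fst (d ! h) \<inter> fst (d ! h'))"

definition ECD :: "int \<Rightarrow> design \<Rightarrow> bool" where
  "ECD \<theta> d \<longleftrightarrow>
     (\<forall>h < length d. \<forall>h' < length d. h \<noteq> h' \<longrightarrow> int (concurrence d h h') = \<theta>)"

definition theta_bar :: "nat \<Rightarrow> nat \<Rightarrow> int" where
  "theta_bar k1 k2 = \<lfloor>(real k1)\<^sup>2 / (real k1 + real k2)\<rfloor>"

definition gamma :: "nat \<Rightarrow> nat \<Rightarrow> real" where
  "gamma k1 k2 = (real k1)\<^sup>2 / (real k1 + real k2) - real_of_int (theta_bar k1 k2)"

definition trace :: "real mat \<Rightarrow> real" where
  "trace A = (\<Sum>i<dim_row A. A $$ (i, i))"

definition max_trace :: "nat \<Rightarrow> nat \<Rightarrow> nat \<Rightarrow> nat \<Rightarrow> real" where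
  "max_trace v r k1 k2 =
     Max ((\<lambda>d. trace (information_matrix v k1 k2 d)) ` design_class v r k1 k2)"

text \<open>Only the values of \<open>f\<close> on the open interval \<open>(0, M)\<close> are relevant.\<close>

definition type1_function :: "real \<Rightarrow> (real \<Rightarrow> real) \<Rightarrow> bool" where
  "type1_function M f \<longleftrightarrow>
     (\<exists>f' f'' f'''.
        continuous_on {0<..<M} f' \<and>
        (\<forall>x \<in> {0<..<M}.
           (f has_real_derivative f' x) (at x) \<and>
           (f' has_real_derivative f'' x) (at x) \<and>
           (f'' has_real_derivative f''' x) (at x) \<and>
           f' x < 0 \<and> f'' x > 0 \<and> f''' x < 0)) \<and>
     filterlim f at_top (at_right 0)"

definition type1_criterion ::
  "nat \<Rightarrow> nat \<Rightarrow> nat \<Rightarrow> (real \<Rightarrow> real) \<Rightarrow> design \<Rightarrow> real" where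
  "type1_criterion v k1 k2 f d = (\<Sum>i = 1..v - 1. f (eigval v k1 k2 d i))"

definition type1_optimal :: "nat \<Rightarrow> nat \<Rightarrow> nat \<Rightarrow> nat \<Rightarrow> design \<Rightarrow> bool" where
  "type1_optimal v r k1 k2 d \<longleftrightarrow>
     d \<in> design_class v r k1 k2 \<and>
     (\<forall>f. type1_function (max_trace v r k1 k2) f \<longrightarrow>
        (\<forall>e \<in> design_class v r k1 k2.
           type1_criterion v k1 k2 f d \<le> type1_criterion v k1 k2 f e))"

definition E_optimal :: "nat \<Rightarrow> nat \<Rightarrow> nat \<Rightarrow> nat \<Rightarrow> design \<Rightarrow> bool" where
  "E_optimal v r k1 k2 d \<longleftrightarrow>
     d \<in> design_class v r k1 k2 \<and>
     (\<forall>e \<in> design_class v r k1 k2. eigval v k1 k2 e 1 \<le> eigval v k1 k2 d 1)"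

end

theory Submission
  imports Defs "Jordan_Normal_Form.Schur_Decomposition"
begin

text \<open>
  Averaging over the two blocks of a replicate is an orthogonal projection, onto the plane spanned
  by the all-ones vector and one contrast vector of that replicate. Hence on the orthogonal complement
  of the all-ones vector \<open>C\<^sub>d\<close> is \<open>r I - U U'\<close>, where \<open>U\<close> has as columns the \<open>r\<close> normalized
  contrasts. The products \<open>U U'\<close> and \<open>U' U\<close> have the same nonzero eigenvalues, so the nonzero
  eigenvalues of \<open>C\<^sub>d\<close> are \<open>v - 1 - r\<close> copies of \<open>r\<close>, the same for all designs, together with the \<open>r\<close>
  numbers \<open>z = r - \<mu>\<close>, where \<open>\<mu>\<close> runs over the eigenvalues of the Gram matrix \<open>G = U' U\<close>
  (\<open>char_poly_information_matrix\<close>, \<open>connected_spectrum\<close>). This Gram matrix has unit diagonal, and its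
  entry at \<open>h \<noteq> h'\<close> is \<open>\<phi>\<^sub>h\<^sub>h\<^sub>' - k1\<^sup>2 / v\<close> times \<open>v / (k1 k2)\<close>.

  The trace of \<open>G\<close> fixes the mean \<open>c = r - 1\<close> of the \<open>z\<close>; the trace of \<open>G\<^sup>2\<close> turns their
  squared deviations from \<open>c\<close> into the sum of the squared off-diagonal entries. As \<open>\<phi>\<close> is an integer
  and \<open>\<gamma> \<le> 1 / 2\<close>, each of these entries is at least \<open>g = \<gamma> v / (k1 k2)\<close> in modulus
  (\<open>off_diagonal_bound\<close>). An equal concurrence design with the parameter of the theorem has all of them
  equal to \<open>-g\<close>, so that its \<open>z\<close> are \<open>c - g\<close>, repeated \<open>r - 1\<close> times, and \<open>c + (r - 1) g\<close>.

  The rest is about \<open>r\<close> real numbers with mean \<open>c\<close> and squared deviations adding up to at least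
  \<open>r (r - 1) g\<^sup>2\<close>. Their minimum is at most \<open>c - g\<close> (\<open>exists_far_below_mean\<close>), which is E-optimality. For
  a convex \<open>f\<close> with negative third derivative the sum of \<open>f\<close> over them is at least the sum over the
  two-valued configuration above (\<open>type1_sum_bound\<close>), which is type-1-optimality.
\<close>

section \<open>Sums of type-1 functions under moment constraints\<close>

lemma third_derivative_zero:
  fixes k' k'' k''' :: "real \<Rightarrow> real"
  assumes "a < b" "b < c"
    and d2: "\<And>x. a \<le> x \<Longrightarrow> x \<le> c \<Longrightarrow> (k' has_real_derivative k'' x) (at x)"
    and d3: "\<And>x. a \<le> x \<Longrightarrow> x \<le> c \<Longrightarrow> (k'' has_real_derivative k''' x) (at x)"
    and "k' a = 0" "k' b = 0" "k' c = 0"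
  shows "\<exists>x. a < x \<and> x < c \<and> k''' x = 0"
proof -
  obtain x where x: "a < x" "x < b" "k' b - k' a = (b - a) * k'' x"
    using MVT2[OF \<open>a < b\<close>, of k' k''] d2 assms(1,2) by (meson le_less_trans less_imp_le)
  obtain y where y: "b < y" "y < c" "k' c - k' b = (c - b) * k'' y"
    using MVT2[OF \<open>b < c\<close>, of k' k''] d2 assms(1,2) by (meson less_le_trans less_imp_le)
  have xy: "x < y" using x y by linarith
  have 0: "k'' x = 0" "k'' y = 0" using x y assms by auto
  obtain t where t: "x < t" "t < y" "k'' y - k'' x = (y - x) * k''' t"
  proof -
    have "\<And>s. x \<le> s \<Longrightarrow> s \<le> y \<Longrightarrow> (k'' has_real_derivative k''' s) (at s)"
      using d3 x y by simp
    from MVT2[OF xy this] that show ?thesis by blast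
  qed
  then have "k''' t = 0" using 0 xy by simp
  then show ?thesis using t x y by (intro exI[of _ t]) auto
qed

text \<open>
  The parabola that agrees with \<open>f\<close> to first order at \<open>p\<close> and in value at \<open>q\<close> is the Hermite
  interpolant of \<open>f\<close> at the nodes \<open>p, p, q\<close>. Its error at \<open>x\<close> is
  \<open>f''' \<xi> / 6 * (x - p)\<^sup>2 * (x - q)\<close> for some \<open>\<xi>\<close>, so that a negative third derivative puts the
  parabola below \<open>f\<close> everywhere to the left of \<open>q\<close>.
\<close>

lemma quadratic_minorant:
  fixes f f' f'' f''' :: "real \<Rightarrow> real"
  assumes d: "\<And>x. 0 < x \<Longrightarrow> x < M \<Longrightarrow> (f has_real_derivative f' x) (at x)"
    "\<And>x. 0 < x \<Longrightarrow> x < M \<Longrightarrow> (f' has_real_derivative f'' x) (at x)"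
    "\<And>x. 0 < x \<Longrightarrow> x < M \<Longrightarrow> (f'' has_real_derivative f''' x) (at x)"
    and neg: "\<And>x. 0 < x \<Longrightarrow> x < M \<Longrightarrow> f''' x < 0"
    and pq: "0 < p" "p < q" "q < M"
    and x: "0 < x" "x \<le> q"
    and \<kappa>: "f q = f p + f' p * (q - p) + \<kappa> * (q - p)\<^sup>2"
  shows "f p + f' p * (x - p) + \<kappa> * (x - p)\<^sup>2 \<le> f x"
proof (cases "x = p \<or> x = q")
  case True
  then show ?thesis using \<kappa> by auto
next
  case False
  define e where "e = (\<lambda>t. f t - (f p + f' p * (t - p) + \<kappa> * (t - p)\<^sup>2))"
  \<comment> \<open>with this \<open>K\<close> the function \<open>k\<close> below also vanishes at \<open>x\<close>; Rolle's theorem then gives \<open>f''' t = 6 * K\<close> for some \<open>t\<close>\<close>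
  define K where "K = e x / ((x - q) * (x - p)\<^sup>2)"
  have ne: "(x - q) * (x - p)\<^sup>2 < 0" using False x by (auto simp: mult_less_0_iff)
  define k where "k = (\<lambda>t. e t - K * ((t - q) * (t - p)\<^sup>2))"
  define k' where "k' = (\<lambda>t. f' t - f' p - 2 * \<kappa> * (t - p) - K * ((t - p)\<^sup>2 + 2 * (t - q) * (t - p)))"
  define k'' where "k'' = (\<lambda>t. f'' t - 2 * \<kappa> - K * (4 * (t - p) + 2 * (t - q)))"
  define k''' where "k''' = (\<lambda>t. f''' t - 6 * K)"
  have k: "(k has_real_derivative k' t) (at t)" if "0 < t" "t < M" for t
    unfolding k_def k'_def e_def
    by (rule derivative_eq_intros d that refl | simp)+ (simp add: algebra_simps)
  have k': "(k' has_real_derivative k'' t) (at t)" if "0 < t" "t < M" for t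
    unfolding k'_def k''_def
    by (rule derivative_eq_intros d that refl | simp)+
  have k'': "(k'' has_real_derivative k''' t) (at t)" if "0 < t" "t < M" for t
    unfolding k''_def k'''_def
    by (rule derivative_eq_intros d that refl | simp)+
  have roots: "k p = 0" "k q = 0" "k x = 0" "k' p = 0"
    using \<kappa> ne by (auto simp: k_def k'_def e_def K_def)
  have rolle: "\<exists>s. a < s \<and> s < b \<and> k' s = 0" if "0 < a" "a < b" "b < M" "k a = 0" "k b = 0" for a b
  proof -
    have "\<And>s. a \<le> s \<Longrightarrow> s \<le> b \<Longrightarrow> (k has_real_derivative k' s) (at s)"
      using k that by simp
    from MVT2[OF \<open>a < b\<close> this] show ?thesis using that by auto
  qed
  have "\<exists>a b c. 0 < a \<and> a < b \<and> b < c \<and> c < M \<and> k' a = 0 \<and> k' b = 0 \<and> k' c = 0"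
  proof (cases "x < p")
    case True
    obtain s where "x < s" "s < p" "k' s = 0" using rolle[of x p] roots x pq True by auto
    moreover obtain t where "p < t" "t < q" "k' t = 0" using rolle[of p q] roots pq by auto
    ultimately show ?thesis using roots x pq by (intro exI[of _ s] exI[of _ p] exI[of _ t]) auto
  next
    case xp: False
    then have "p < x" "x < q" using False x by auto
    then obtain s where "p < s" "s < x" "k' s = 0" using rolle[of p x] roots pq by auto
    moreover obtain t where "x < t" "t < q" "k' t = 0" using rolle[of x q] roots x pq \<open>x < q\<close> by auto
    ultimately show ?thesis using roots x pq by (intro exI[of _ p] exI[of _ s] exI[of _ t]) auto
  qed
  then obtain a b c where abc: "0 < a" "a < b" "b < c" "c < M" "k' a = 0" "k' b = 0" "k' c = 0"
    by blast
  obtain t where t: "a < t" "t < c" "k''' t = 0"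
    using third_derivative_zero[of a b c k' k'' k'''] k' k'' abc by force
  have "f''' t < 0" by (rule neg) (use t abc in auto)
  then have "K < 0" using t by (simp add: k'''_def)
  then have "0 < e x" using ne by (simp add: K_def divide_less_0_iff not_less)
  then show ?thesis by (simp add: e_def)
qed

lemma above_tangent:
  fixes f f' f'' :: "real \<Rightarrow> real"
  assumes d: "\<And>x. 0 < x \<Longrightarrow> x < M \<Longrightarrow> (f has_real_derivative f' x) (at x)"
    "\<And>x. 0 < x \<Longrightarrow> x < M \<Longrightarrow> (f' has_real_derivative f'' x) (at x)"
    and pos: "\<And>x. 0 < x \<Longrightarrow> x < M \<Longrightarrow> f'' x > 0"
    and p: "0 < p" "p < M" and x: "0 < x" "x < M"
  shows "f p + f' p * (x - p) \<le> f x"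
proof -
  have mono: "f' a \<le> f' b" if "0 < a" "a \<le> b" "b < M" for a b
    using DERIV_nonneg_imp_nondecreasing[of a b f'] d(2) pos that
    by (meson less_imp_le less_le_trans le_less_trans)
  consider "x < p" | "x = p" | "p < x" by linarith
  then show ?thesis
  proof cases
    case 1
    have "\<And>s. x \<le> s \<Longrightarrow> s \<le> p \<Longrightarrow> (f has_real_derivative f' s) (at s)"
      using d p x by simp
    from MVT2[OF 1 this] obtain t where "x < t" "t < p" "f p - f x = (p - x) * f' t" by blast
    moreover from this have "(p - x) * f' t \<le> (p - x) * f' p"
      using mono[of t p] p x by (intro mult_left_mono) auto
    ultimately show ?thesis by (simp add: algebra_simps)
  next
    case 3
    have "\<And>s. p \<le> s \<Longrightarrow> s \<le> x \<Longrightarrow> (f has_real_derivative f' s) (at s)"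
      using d p x by simp
    from MVT2[OF 3 this] obtain t where "p < t" "t < x" "f x - f p = (x - p) * f' t" by blast
    moreover from this have "(x - p) * f' p \<le> (x - p) * f' t"
      using mono[of p t] p x by (intro mult_left_mono) auto
    ultimately show ?thesis by (simp add: algebra_simps)
  qed simp
qed

text \<open>
  Among \<open>r\<close> numbers with mean \<open>c\<close> whose squared deviations from \<open>c\<close> add up to at least
  \<open>r (r - 1) g\<^sup>2\<close>, the sum of \<open>f\<close> is smallest when \<open>r - 1\<close> of them are \<open>p = c - g\<close> and one is
  \<open>q = c + (r - 1) g\<close>, where mean and squared deviations are exactly as prescribed.
  If all numbers are below \<open>q\<close>, the parabola of \<open>quadratic_minorant\<close> minorizes \<open>f\<close> at all of them; its
  leading coefficient is nonnegative since \<open>f\<close> is convex, so its sum can only grow with the squared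
  deviations. If some number is at least \<open>q\<close>, then \<open>f\<close> is bounded there
  by the tangent at \<open>q\<close>, whose slope is at least \<open>f' p\<close>, and at the other numbers by the tangent at
  \<open>p\<close>; the linear terms cancel because the mean is fixed.
\<close>

lemma type1_sum_bound:
  fixes f f' f'' f''' :: "real \<Rightarrow> real" and z :: "'i \<Rightarrow> real"
  assumes d: "\<And>x. 0 < x \<Longrightarrow> x < M \<Longrightarrow> (f has_real_derivative f' x) (at x)"
    "\<And>x. 0 < x \<Longrightarrow> x < M \<Longrightarrow> (f' has_real_derivative f'' x) (at x)"
    "\<And>x. 0 < x \<Longrightarrow> x < M \<Longrightarrow> (f'' has_real_derivative f''' x) (at x)"
    and pos: "\<And>x. 0 < x \<Longrightarrow> x < M \<Longrightarrow> f'' x > 0"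
    and neg: "\<And>x. 0 < x \<Longrightarrow> x < M \<Longrightarrow> f''' x < 0"
    and I: "finite I" "card I = r" "0 < r"
    and z: "\<And>i. i \<in> I \<Longrightarrow> 0 < z i" "\<And>i. i \<in> I \<Longrightarrow> z i < M"
    and sum: "(\<Sum>i\<in>I. z i) = real r * c"
    and sq: "real r * (real r - 1) * g\<^sup>2 \<le> (\<Sum>i\<in>I. (z i - c)\<^sup>2)"
    and g: "0 \<le> g" and p: "0 < c - g" and q: "c + (real r - 1) * g < M"
  shows "(real r - 1) * f (c - g) + f (c + (real r - 1) * g) \<le> (\<Sum>i\<in>I. f (z i))"
proof -
  define p where "p = c - g"
  define q where "q = c + (real r - 1) * g"
  have r1: "0 \<le> real r - 1" using I by simp
  have pq: "0 < p" "p \<le> q" "q < M" using p q g r1 mult_nonneg_nonneg[OF r1 g] unfolding p_def q_def by linarith+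
  have bal: "(real r - 1) * p + q = real r * c" by (simp add: p_def q_def algebra_simps)
  have tangent: "f a + f' a * (x - a) \<le> f x" if "0 < a" "a < M" "0 < x" "x < M" for a x
    by (rule above_tangent[of M f f' f'']) (use d pos that in auto)
  show ?thesis
  proof (cases "\<exists>m\<in>I. q \<le> z m")
    case True
    then obtain m where m: "m \<in> I" "q \<le> z m" by blast
    have f'mono: "f' p \<le> f' q"
      using DERIV_nonneg_imp_nondecreasing[of p q f'] pq d(2) pos
      by (meson less_imp_le less_le_trans le_less_trans)
    have "f q + f' p * (z m - q) \<le> f q + f' q * (z m - q)"
      using f'mono m by (simp add: mult_right_mono)
    also have "\<dots> \<le> f (z m)" using tangent[of q "z m"] pq z m by auto
    finally have fm: "f q + f' p * (z m - q) \<le> f (z m)" .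
    have cardm: "real (card (I - {m})) = real r - 1" using m I by (simp add: of_nat_diff)
    have "(real r - 1) * (f p - f' p * p) + f' p * (\<Sum>i\<in>I - {m}. z i)
        = (\<Sum>i\<in>I - {m}. f p + f' p * (z i - p))"
      by (simp add: sum.distrib sum_subtractf sum_distrib_left cardm algebra_simps)
    also have "\<dots> \<le> (\<Sum>i\<in>I - {m}. f (z i))"
      by (intro sum_mono tangent) (use pq z in auto)
    finally have "(real r - 1) * (f p - f' p * p) + f' p * (\<Sum>i\<in>I - {m}. z i) + f q + f' p * (z m - q)
        \<le> (\<Sum>i\<in>I. f (z i))"
      using fm m I by (simp add: sum.remove[of I m])
    moreover have "(\<Sum>i\<in>I - {m}. z i) = real r * c - z m"
      using sum m I by (simp add: sum.remove[of I m])
    moreover have "(real r - 1) * (f p - f' p * p) + f' p * (real r * c - z m) + f q + f' p * (z m - q)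
        = (real r - 1) * f p + f q"
      unfolding bal[symmetric] by (simp add: algebra_simps)
    ultimately show ?thesis by (simp add: p_def q_def)
  next
    case False
    then have lt: "z i < q" if "i \<in> I" for i using that by auto
    have "I \<noteq> {}" using I by auto
    then have "(\<Sum>i\<in>I. z i) < (\<Sum>i\<in>I. q)" using I lt by (intro sum_strict_mono) auto
    then have "c < q" using sum I by simp
    then have "p < q" using g by (simp add: p_def)
    define \<kappa> where "\<kappa> = (f q - f p - f' p * (q - p)) / (q - p)\<^sup>2"
    have \<kappa>: "f q = f p + f' p * (q - p) + \<kappa> * (q - p)\<^sup>2"
      using \<open>p < q\<close> by (simp add: \<kappa>_def)
    have \<kappa>0: "0 \<le> \<kappa>" using tangent[of p q] pq by (simp add: \<kappa>_def)
    have S: "(\<Sum>i\<in>I. (z i - p)\<^sup>2) = (\<Sum>i\<in>I. (z i - c)\<^sup>2) + real r * g\<^sup>2"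
    proof -
      have "(\<Sum>i\<in>I. (z i - p)\<^sup>2) = (\<Sum>i\<in>I. (z i - c)\<^sup>2 + 2 * g * z i + (g\<^sup>2 - 2 * g * c))"
        by (rule sum.cong) (auto simp: p_def power2_eq_square algebra_simps)
      also have "\<dots> = (\<Sum>i\<in>I. (z i - c)\<^sup>2) + 2 * g * (real r * c) + real r * (g\<^sup>2 - 2 * g * c)"
        unfolding sum[symmetric] by (simp add: sum.distrib sum_distrib_left I)
      finally show ?thesis by (simp add: algebra_simps)
    qed
    have qp: "q - p = real r * g" by (simp add: p_def q_def algebra_simps)
    have "(real r - 1) * f p + f q = real r * f p + f' p * (real r * c - real r * p) + \<kappa> * (q - p)\<^sup>2"
      unfolding \<kappa> bal[symmetric] by (simp add: algebra_simps)
    also have "\<dots> \<le> real r * f p + f' p * (real r * c - real r * p) + \<kappa> * (\<Sum>i\<in>I. (z i - p)\<^sup>2)"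
      unfolding S qp using sq \<kappa>0
      by (intro add_left_mono mult_left_mono) (auto simp: power2_eq_square algebra_simps)
    also have "\<dots> = (\<Sum>i\<in>I. f p + f' p * (z i - p) + \<kappa> * (z i - p)\<^sup>2)"
      unfolding sum[symmetric]
      by (simp add: sum.distrib sum_distrib_left[symmetric] sum_subtractf I)
    also have "\<dots> \<le> (\<Sum>i\<in>I. f (z i))"
      by (intro sum_mono quadratic_minorant[of M f f' f'' f''' p q])
         (use d neg pq \<open>p < q\<close> \<kappa> lt z in \<open>auto intro: less_imp_le\<close>)
    finally show ?thesis by (simp add: p_def q_def)
  qed
qed

text \<open>
  If all deviations \<open>z i - c\<close> were above \<open>-g\<close>, the positive numbers \<open>y i = z i - (c - g)\<close> would
  have sum \<open>r g\<close> and therefore \<open>\<Sum> (y i)\<^sup>2 < (\<Sum> y i)\<^sup>2 = r\<^sup>2 g\<^sup>2\<close>, which forces too small a second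
  moment. Strictness needs at least two summands.
\<close>

lemma exists_far_below_mean:
  fixes z :: "'i \<Rightarrow> real"
  assumes I: "finite I" "card I = r" "2 \<le> r"
    and sum: "(\<Sum>i\<in>I. z i) = real r * c"
    and sq: "real r * (real r - 1) * g\<^sup>2 \<le> (\<Sum>i\<in>I. (z i - c)\<^sup>2)"
  shows "\<exists>i\<in>I. z i \<le> c - g"
proof (rule ccontr)
  assume far: "\<not> ?thesis"
  define y where "y = (\<lambda>i. z i - (c - g))"
  have y: "0 < y i" if "i \<in> I" for i using far that by (auto simp: y_def not_le)
  have S: "(\<Sum>i\<in>I. y i) = real r * g"
    using sum I by (simp add: y_def sum_subtractf algebra_simps)
  have lt: "y i < real r * g" if i: "i \<in> I" for i
  proof -
    have "I - {i} \<noteq> {}"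
      using I i card_mono[of "{i}" I] by auto
    then have "0 < (\<Sum>j\<in>I - {i}. y j)" using I y by (intro sum_pos) auto
    then show ?thesis using S i I by (simp add: sum.remove[of I i])
  qed
  have ne: "I \<noteq> {}" using I by auto
  have "(\<Sum>i\<in>I. y i * y i) < (\<Sum>i\<in>I. y i * (real r * g))"
    using I ne y lt by (intro sum_strict_mono mult_strict_left_mono) auto
  also have "\<dots> = (real r * g)\<^sup>2" by (simp add: sum_distrib_right[symmetric] S power2_eq_square)
  finally have A: "(\<Sum>i\<in>I. y i * y i) < (real r * g)\<^sup>2" .
  have "(\<Sum>i\<in>I. (z i - c)\<^sup>2) = (\<Sum>i\<in>I. y i * y i - 2 * g * y i + g\<^sup>2)"
    by (rule sum.cong) (auto simp: y_def power2_eq_square algebra_simps)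
  also have "\<dots> = (\<Sum>i\<in>I. y i * y i) - 2 * g * (real r * g) + real r * g\<^sup>2"
    unfolding S[symmetric] by (simp add: sum.distrib sum_subtractf sum_distrib_left I)
  finally show False using A sq by (simp add: power2_eq_square algebra_simps)
qed

section \<open>Characteristic polynomials and rank\<close>

text \<open>
  Sylvester's determinant identity. The block matrix with rows \<open>(x I, A)\<close> and \<open>(B, I)\<close> becomes block
  triangular both after a column operation, which exposes \<open>x I - A B\<close>, and after a row operation,
  which exposes \<open>x I - B A\<close>.
\<close>

lemma char_poly_mult_comm:
  fixes A B :: "'a :: field_char_0 mat"
  assumes A: "A \<in> carrier_mat n m" and B: "B \<in> carrier_mat m n" and "m \<le> n"
  shows "char_poly (A * B) = monom 1 (n - m) * char_poly (B * A)"
proof -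
  have eval: "x ^ m * poly (char_poly (A * B)) x = x ^ n * poly (char_poly (B * A)) x" for x
  proof -
    define M where "M = four_block_mat (x \<cdot>\<^sub>m 1\<^sub>m n) A B (1\<^sub>m m)"
    \<comment> \<open>row operation \<open>L\<close>, column operation \<open>R\<close>; scaling by \<open>x\<close> in \<open>L\<close> accounts for the difference of the sizes\<close>
    define L where "L = four_block_mat (1\<^sub>m n) (0\<^sub>m n m) (- B) (x \<cdot>\<^sub>m 1\<^sub>m m)"
    define R where "R = four_block_mat (1\<^sub>m n) (0\<^sub>m n m) (- B) (1\<^sub>m m)"
    have carr: "M \<in> carrier_mat (n + m) (n + m)" "L \<in> carrier_mat (n + m) (n + m)"
      "R \<in> carrier_mat (n + m) (n + m)" using A B by (auto simp: M_def L_def R_def)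
    have cAB: "poly (char_poly (A * B)) x = det (x \<cdot>\<^sub>m 1\<^sub>m n - A * B)"
      using A B by (subst char_poly_matrix[of _ n])
         (auto simp: char_matrix_def intro!: arg_cong[of _ _ det] eq_matI)
    have cBA: "poly (char_poly (B * A)) x = det (x \<cdot>\<^sub>m 1\<^sub>m m - B * A)"
      using A B by (subst char_poly_matrix[of _ m])
         (auto simp: char_matrix_def intro!: arg_cong[of _ _ det] eq_matI)
    have "M * R = four_block_mat (x \<cdot>\<^sub>m 1\<^sub>m n - A * B) A (0\<^sub>m m n) (1\<^sub>m m)"
      unfolding M_def R_def
      by (subst mult_four_block_mat[of _ n n _ m _ m _ _ n _ m])
         (use A B in \<open>auto intro!: arg_cong2[of _ _ _ _ "\<lambda>a b. four_block_mat a A b (1\<^sub>m m)"] eq_matI\<close>)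
    then have 1: "det (M * R) = poly (char_poly (A * B)) x"
      using A B by (simp add: cAB, subst det_four_block_mat_lower_left_zero[of _ n _ m]) auto
    have "det R = 1" unfolding R_def using B by (subst det_four_block_mat_upper_right_zero[of _ n _ m]) auto
    then have 1: "det M = poly (char_poly (A * B)) x" using 1 det_mult[OF carr(1,3)] by simp
    have "L * M = four_block_mat (x \<cdot>\<^sub>m 1\<^sub>m n) A (0\<^sub>m m n) (x \<cdot>\<^sub>m 1\<^sub>m m - B * A)"
      unfolding M_def L_def
      by (subst mult_four_block_mat[of _ n n _ m _ m _ _ n _ m])
         (use A B in \<open>auto intro!: arg_cong2[of _ _ _ _ "four_block_mat (x \<cdot>\<^sub>m 1\<^sub>m n) A"] eq_matI\<close>)
    then have 2: "det (L * M) = x ^ n * poly (char_poly (B * A)) x"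
      using A B by (simp add: cBA, subst det_four_block_mat_lower_left_zero[of _ n _ m]) auto
    have "det L = x ^ m" unfolding L_def using B by (subst det_four_block_mat_upper_right_zero[of _ n _ m]) auto
    then show ?thesis using 1 2 det_mult[OF carr(2,1)] by simp
  qed
  have "monom 1 m * char_poly (A * B) = monom 1 m * (monom 1 (n - m) * char_poly (B * A))"
    using \<open>m \<le> n\<close>
    by (intro iffD1[OF poly_eq_poly_eq_iff] ext)
       (simp add: poly_monom eval mult.assoc[symmetric] power_add[symmetric])
  then show ?thesis by simp
qed

lemma char_poly_scalar_minus:
  fixes A :: "'a :: field_char_0 mat"
  assumes A: "A \<in> carrier_mat n n" and es: "char_poly A = (\<Prod>a\<leftarrow>es. [:- a, 1:])"
  shows "char_poly (c \<cdot>\<^sub>m 1\<^sub>m n - A) = (\<Prod>a\<leftarrow>es. [:- (c - a), 1:])"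
proof (intro iffD1[OF poly_eq_poly_eq_iff] ext)
  fix x
  have len: "length es = n"
    using degree_monic_char_poly[OF A] degree_linear_factors[of uminus es] es by simp
  have "- char_matrix (c \<cdot>\<^sub>m 1\<^sub>m n - A) x = (-1) \<cdot>\<^sub>m (- char_matrix A (c - x))"
    using A by (auto simp: char_matrix_def intro!: eq_matI)
  then have "poly (char_poly (c \<cdot>\<^sub>m 1\<^sub>m n - A)) x = det ((-1) \<cdot>\<^sub>m (- char_matrix A (c - x)))"
    using A by (subst char_poly_matrix[of _ n]) auto
  also have "\<dots> = (-1) ^ n * poly (char_poly A) (c - x)"
    using A by (simp add: char_poly_matrix[OF A] char_matrix_def)
  also have "\<dots> = (\<Prod>a\<leftarrow>es. - 1 * (c - x - a))"
    unfolding es len[symmetric] by (induct es) (auto simp: poly_prod_list algebra_simps)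
  also have "\<dots> = poly (\<Prod>a\<leftarrow>es. [:- (c - a), 1:]) x"
    by (induct es) (auto simp: algebra_simps)
  finally show "poly (char_poly (c \<cdot>\<^sub>m 1\<^sub>m n - A)) x = poly (\<Prod>a\<leftarrow>es. [:- (c - a), 1:]) x" .
qed

lemma proots_linear_factors: "proots (\<Prod>a\<leftarrow>es. [:- a, 1:]) = mset (es :: 'a :: idom list)"
proof (induct es)
  case (Cons a es)
  have "(\<Prod>a\<leftarrow>es. [:- a, 1:]) \<noteq> 0" by (auto simp: prod_list_zero_iff)
  then have "proots ([:- a, 1:] * (\<Prod>a\<leftarrow>es. [:- a, 1:])) = {#a#} + mset es"
    using Cons by (subst proots_mult) (auto simp del: mult_pCons_left)
  then show ?case by simp
qed simp

lemma trace_mult_comm: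
  assumes "A \<in> carrier_mat n m" "B \<in> carrier_mat m n"
  shows "trace (A * B) = trace (B * A)"
proof -
  have "trace (A * B) = (\<Sum>i<n. \<Sum>j<m. A $$ (i, j) * B $$ (j, i))"
    using assms by (simp add: trace_def scalar_prod_def atLeast0LessThan)
  also have "\<dots> = (\<Sum>j<m. \<Sum>i<n. B $$ (j, i) * A $$ (i, j))"
    by (subst sum.swap) (simp add: mult.commute)
  also have "\<dots> = trace (B * A)"
    using assms by (simp add: trace_def scalar_prod_def atLeast0LessThan)
  finally show ?thesis .
qed

lemma trace_similar:
  assumes sim: "similar_mat_wit A B P Q" and A: "A \<in> carrier_mat n n"
  shows "trace A = trace B"
proof -
  note w = similar_mat_witD2[OF A sim]
  have "trace A = trace (P * (B * Q))" using w by (simp add: assoc_mult_mat[of P n n B n Q n])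
  also have "\<dots> = trace ((B * Q) * P)" using w by (intro trace_mult_comm) auto
  also have "\<dots> = trace B" using w by (simp add: assoc_mult_mat[of B n n Q n P n])
  finally show ?thesis .
qed

text \<open>
  A matrix whose characteristic polynomial splits is similar to an upper triangular one by Schur's
  decomposition, and the squares of the diagonal entries of a triangular matrix are the diagonal
  entries of its square.
\<close>

lemma eigenvalue_moments:
  fixes A :: "real mat"
  assumes A: "A \<in> carrier_mat n n" and es: "char_poly A = (\<Prod>a\<leftarrow>es. [:- a, 1:])"
  shows "length es = n"
    and "(\<Sum>i<n. es ! i) = trace A"
    and "(\<Sum>i<n. (es ! i)\<^sup>2) = trace (A * A)"
proof -
  show len: "length es = n"
    using degree_monic_char_poly[OF A] degree_linear_factors[of uminus es] es by simp
  obtain B P Q where dec: "schur_decomposition A es = (B, P, Q)" by (cases "schur_decomposition A es") auto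
  from schur_decomposition[OF A es dec]
  have sim: "similar_mat_wit A B P Q" and ut: "upper_triangular B" and diag: "diag_mat B = es" by auto
  note w = similar_mat_witD2[OF A sim]
  have ii: "B $$ (i, i) = es ! i" if "i < n" for i
    using diag that w by (auto simp: diag_mat_def)
  show "(\<Sum>i<n. es ! i) = trace A"
    using trace_similar[OF sim A] w ii by (simp add: trace_def)
  have "similar_mat_wit (A * A) (B * B) P Q"
    using similar_mat_wit_pow[OF sim, of 2] A w by (simp add: numeral_2_eq_2)
  then have "trace (A * A) = trace (B * B)" using A by (intro trace_similar) auto
  also have "\<dots> = (\<Sum>i<n. \<Sum>j<n. B $$ (i, j) * B $$ (j, i))"
    using w by (simp add: trace_def scalar_prod_def atLeast0LessThan)
  also have "\<dots> = (\<Sum>i<n. (es ! i)\<^sup>2)"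
  proof (rule sum.cong[OF refl])
    fix i assume i: "i \<in> {..<n}"
    have "B $$ (i, j) * B $$ (j, i) = (if j = i then (es ! i)\<^sup>2 else 0)" if "j < n" for j
      using ut w i ii that upper_triangularD[OF ut, of i j] upper_triangularD[OF ut, of j i]
      by (cases j i rule: linorder_cases) (auto simp: power2_eq_square)
    then show "(\<Sum>j<n. B $$ (i, j) * B $$ (j, i)) = (es ! i)\<^sup>2" using i by simp
  qed
  finally show "(\<Sum>i<n. (es ! i)\<^sup>2) = trace (A * A)" by simp
qed

text \<open>
  For an eigenvector \<open>x\<close> the Hermitian form \<open>x\<^sup>* A x\<close> is its own conjugate, and it equals \<open>a\<close> times
  the positive number \<open>x\<^sup>* x\<close>.
\<close>

lemma symmetric_complex_eigenvalue_real:
  fixes A :: "real mat"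
  assumes A: "A \<in> carrier_mat n n" and sym: "\<And>i j. i < n \<Longrightarrow> j < n \<Longrightarrow> A $$ (i, j) = A $$ (j, i)"
    and ev: "eigenvalue (map_mat complex_of_real A) a"
  shows "a \<in> \<real>"
proof -
  obtain x where x: "x \<in> carrier_vec n" "x \<noteq> 0\<^sub>v n" "map_mat complex_of_real A *\<^sub>v x = a \<cdot>\<^sub>v x"
    using ev A by (auto simp: eigenvalue_def eigenvector_def)
  define q where "q = (\<Sum>i<n. \<Sum>j<n. cnj (x $ i) * (complex_of_real (A $$ (i, j)) * x $ j))"
  define s where "s = (\<Sum>i<n. (cmod (x $ i))\<^sup>2)"
  have row: "(\<Sum>j<n. complex_of_real (A $$ (i, j)) * x $ j) = a * x $ i" if "i < n" for i
    using arg_cong[OF x(3), of "\<lambda>y. y $ i"] that A x(1) by (simp add: scalar_prod_def atLeast0LessThan)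
  have "q = (\<Sum>i<n. cnj (x $ i) * (a * x $ i))"
    by (simp add: q_def sum_distrib_left[symmetric] row)
  also have "\<dots> = a * complex_of_real s"
    by (simp add: s_def sum_distrib_left complex_norm_square mult_ac del: of_real_power)
  finally have qs: "q = a * complex_of_real s" .
  have "cnj q = (\<Sum>i<n. \<Sum>j<n. x $ i * (complex_of_real (A $$ (i, j)) * cnj (x $ j)))"
    by (simp add: q_def)
  also have "\<dots> = q"
    unfolding q_def by (subst sum.swap) (auto intro!: sum.cong simp: sym mult_ac)
  finally have "q \<in> \<real>" by (simp add: Reals_cnj_iff)
  obtain i where "i < n" "x $ i \<noteq> 0" using x(1,2) by (metis carrier_vecD eq_vecI index_zero_vec)
  then have "0 < s" unfolding s_def by (intro sum_pos2[of _ i]) auto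
  then have "a = q / complex_of_real s" using qs by simp
  then show ?thesis using \<open>q \<in> \<real>\<close> by simp
qed

lemma symmetric_char_poly_splits:
  fixes A :: "real mat"
  assumes A: "A \<in> carrier_mat n n" and sym: "\<And>i j. i < n \<Longrightarrow> j < n \<Longrightarrow> A $$ (i, j) = A $$ (j, i)"
  obtains es where "char_poly A = (\<Prod>a\<leftarrow>es. [:- a, 1:])"
proof -
  let ?C = "map_mat complex_of_real A"
  have C: "?C \<in> carrier_mat n n" using A by simp
  obtain as where as: "char_poly ?C = (\<Prod>a\<leftarrow>as. [:- a, 1:])" using char_poly_factorized[OF C] by blast
  have real: "a \<in> \<real>" if "a \<in> set as" for a
  proof (rule symmetric_complex_eigenvalue_real[OF A sym])
    have "poly (char_poly ?C) a = 0" unfolding as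
      using that by (auto simp: poly_prod_list prod_list_zero_iff)
    then show "eigenvalue ?C a" using eigenvalue_root_char_poly[OF C] by simp
  qed
  have "char_poly A = (\<Prod>a\<leftarrow>map Re as. [:- a, 1:])"
  proof (intro iffD1[OF poly_eq_poly_eq_iff] ext)
    fix x :: real
    have hom: "poly (map_poly complex_of_real p) (complex_of_real x) = complex_of_real (poly p x)" for p
      by (induct p) (simp_all add: map_poly_pCons)
    have "complex_of_real (poly (char_poly A) x) = poly (\<Prod>a\<leftarrow>as. [:- a, 1:]) (complex_of_real x)"
      unfolding as[symmetric] of_real_hom.char_poly_hom[OF A] by (rule hom[symmetric])
    also have "\<dots> = complex_of_real (poly (\<Prod>a\<leftarrow>map Re as. [:- a, 1:]) x)"
      using real by (induct as) (simp_all add: of_real_Re algebra_simps)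
    finally show "poly (char_poly A) x = poly (\<Prod>a\<leftarrow>map Re as. [:- a, 1:]) x"
      by (simp only: of_real_eq_iff)
  qed
  then show thesis by (rule that)
qed

text \<open>
  A rank of at least \<open>n - 1\<close> would provide \<open>n - 1\<close> linearly independent columns, missing only some
  index \<open>j\<close>; a nonzero kernel vector with \<open>j\<close>-th entry zero is a linear dependence among them. This
  criterion turns two independent kernel vectors into a bound on the rank.
\<close>

lemma kernel_meets_hyperplanes_low_rank:
  fixes A :: "'a :: field mat"
  assumes A: "A \<in> carrier_mat n n"
    and ker: "\<And>j. j < n \<Longrightarrow> \<exists>x \<in> carrier_vec n. x \<noteq> 0\<^sub>v n \<and> A *\<^sub>v x = 0\<^sub>v n \<and> x $ j = 0"
    and n: "0 < n"
  shows "vec_space.rank n A < n - 1"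
proof (rule ccontr)
  interpret vec_space "TYPE('a)" n .
  assume hi: "\<not> rank A < n - 1"
  obtain x where x: "x \<in> carrier_vec n" "x \<noteq> 0\<^sub>v n" "A *\<^sub>v x = 0\<^sub>v n" using ker[OF n] by auto
  then have "det A = 0" using det_0_iff_vec_prod_zero_field[OF A] by auto
  then have rk: "rank A = n - 1" using det_zero_low_rank[OF A] hi by simp
  obtain T where T: "maximal T (\<lambda>T. T \<subseteq> set (cols A) \<and> lin_indpt T)"
    using maximal_exists_superset[of "set (cols A)" "(\<lambda>T. T \<subseteq> set (cols A) \<and> lin_indpt T)" "{}"]
      finite_set finite_lin_indpt2[of "{}"] by auto
  have cT: "card T = n - 1" using rank_card_indpt[OF A T] rk by simp
  have Ts: "T \<subseteq> col A ` {0..<n}" and li: "lin_indpt T" using T A by (auto simp: maximal_def cols_def)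
  obtain J where J: "J \<subseteq> {0..<n}" "inj_on (col A) J" "T = col A ` J"
    using Ts by (auto simp: subset_image_inj)
  have cJ: "card J = n - 1" using J cT card_image by metis
  then have "card ({0..<n} - J) = 1" using J n by (simp add: card_Diff_subset finite_subset[OF J(1)])
  then obtain j where j: "{0..<n} - J = {j}" by (auto simp: card_1_singleton_iff)
  then have Jj: "J = {0..<n} - {j}" "j < n" using J by auto
  obtain x where x: "x \<in> carrier_vec n" "x \<noteq> 0\<^sub>v n" "A *\<^sub>v x = 0\<^sub>v n" "x $ j = 0" using ker[OF Jj(2)] by auto
  define js where "js = sorted_list_of_set J"
  have js: "set js = J" "distinct js" "length js = n - 1"
    using cJ finite_subset[OF J(1)] by (auto simp: js_def)
  define A' where "A' = mat_of_cols n (map (col A) js)"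
  have A': "A' \<in> carrier_mat n (n - 1)" using js by (simp add: A'_def mat_of_cols_def)
  have cols': "cols A' = map (col A) js" unfolding A'_def
    using A by (intro cols_mat_of_cols) (auto simp: carrier_vecI)
  define y where "y = vec (n - 1) (\<lambda>i. x $ (js ! i))"
  have "A' *\<^sub>v y = A *\<^sub>v x"
  proof (rule eq_vecI)
    fix i assume "i < dim_vec (A *\<^sub>v x)"
    then have i: "i < n" using A by simp
    have bij: "bij_betw ((!) js) {..<n - 1} J" using js bij_betw_nth[of js] by simp
    have "(A' *\<^sub>v y) $ i = (\<Sum>k<n - 1. A $$ (i, js ! k) * x $ (js ! k))"
    proof -
      have "col A (js ! k) $ i = A $$ (i, js ! k)" if "k < n - 1" for k
        using i A js J(1) nth_mem[of k js] that by (auto simp del: nth_mem)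
      then show ?thesis
        using i A' js by (auto simp: A'_def y_def scalar_prod_def mat_of_cols_index
            atLeast0LessThan intro!: sum.cong)
    qed
    also have "\<dots> = (\<Sum>k\<in>J. A $$ (i, k) * x $ k)"
      by (rule sum.reindex_bij_betw[OF bij])
    also have "\<dots> = (\<Sum>k\<in>{0..<n}. A $$ (i, k) * x $ k)"
      by (rule sum.mono_neutral_left) (auto simp: Jj x)
    also have "\<dots> = (A *\<^sub>v x) $ i" using A x(1) i by (simp add: scalar_prod_def)
    finally show "(A' *\<^sub>v y) $ i = (A *\<^sub>v x) $ i" .
  qed (use A A' in auto)
  moreover have "y \<noteq> 0\<^sub>v (n - 1)"
  proof
    assume 0: "y = 0\<^sub>v (n - 1)"
    have "x $ k = 0" if "k < n" for k
    proof (cases "k = j")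
      case False
      then have "k \<in> set js" using js(1) Jj that by simp
      then obtain i where "i < n - 1" "js ! i = k" using js(3) by (auto simp: in_set_conv_nth)
      then show ?thesis using arg_cong[OF 0, of "\<lambda>v. v $ i"] by (simp add: y_def)
    qed (use x in simp)
    then show False using x by (metis carrier_vecD eq_vecI index_zero_vec)
  qed
  moreover have "distinct (cols A')" using js J by (simp add: cols' distinct_map)
  ultimately have "lin_dep (set (cols A'))"
    using x A' by (intro lin_depI[of A' "n - 1" y]) (auto simp: y_def)
  then show False using li js J by (simp add: cols')
qed

section \<open>The spectrum of the information matrix\<close>

text \<open>
  Up to scaling, the unique function that is constant on each of the two blocks of replicate \<open>h\<close>
  and sums to zero: \<open>k2\<close> on the block of size \<open>k1\<close>, and \<open>-k1\<close> on the block of size \<open>k2\<close>.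
\<close>

definition contrast :: "nat \<Rightarrow> nat \<Rightarrow> design \<Rightarrow> nat \<Rightarrow> nat \<Rightarrow> real" where
  "contrast k1 k2 d h i = real (k1 + k2) * (if i \<in> fst (d ! h) then 1 else 0) - real k1"

text \<open>
  The Gram matrix of the normalized contrasts; see \<open>contrast_inner\<close>.
\<close>

definition gram :: "nat \<Rightarrow> nat \<Rightarrow> design \<Rightarrow> real mat" where
  "gram k1 k2 d = mat (length d) (length d) (\<lambda>(h, h').
     real (k1 + k2) / (real k1 * real k2)
       * (real (concurrence d h h') - (real k1)\<^sup>2 / real (k1 + k2)))"

lemma sum_pairs: "(\<Sum>b<2 * r. f b) = (\<Sum>h<r. f (2 * h) + f (2 * h + 1 :: nat))" for f :: "nat \<Rightarrow> real"
  by (induct r) (simp_all add: add.assoc)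

context
  fixes v r k1 k2 :: nat and d :: design
  assumes res: "resolvable_design v r k1 k2 d"
    and k: "0 < k1" "0 < k2" and v: "v = k1 + k2"
begin

private abbreviation (input) w where "w \<equiv> contrast k1 k2 d"
private abbreviation (input) \<kappa> where "\<kappa> \<equiv> real k1 * real k2 * real v"

lemma length_design: "length d = r" using res by (simp add: resolvable_design_def)

lemma replicate_blocks:
  assumes "h < r"
  shows "fst (d ! h) \<subseteq> {..<v}" "card (fst (d ! h)) = k1" "snd (d ! h) = {..<v} - fst (d ! h)"
proof -
  have "d ! h \<in> set d" using assms length_design by simp
  then have "fst (d ! h) \<union> snd (d ! h) = {0..<v} \<and> fst (d ! h) \<inter> snd (d ! h) = {}
      \<and> card (fst (d ! h)) = k1"
    using res unfolding resolvable_design_def by (metis (mono_tags, lifting) case_prod_unfold)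
  then show "fst (d ! h) \<subseteq> {..<v}" "card (fst (d ! h)) = k1" "snd (d ! h) = {..<v} - fst (d ! h)"
    by (auto simp: atLeast0LessThan)
qed

lemma concurrence_self: "h < r \<Longrightarrow> concurrence d h h = k1"
  by (simp add: concurrence_def replicate_blocks)

lemma contrast_sum:
  assumes "h < r"
  shows "(\<Sum>i<v. w h i) = 0"
proof -
  have "(\<Sum>i<v. if i \<in> fst (d ! h) then 1 else 0 :: real) = real k1"
    using replicate_blocks[OF assms] by (simp add: sum.If_cases Int_absorb1)
  then show ?thesis
    by (simp add: contrast_def sum_subtractf sum_distrib_left[symmetric] v)
qed

lemma contrast_inner:
  assumes h: "h < r" and h': "h' < r"
  shows "(\<Sum>i<v. w h i * w h' i) = \<kappa> * gram k1 k2 d $$ (h, h')"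
proof -
  let ?a = "\<lambda>h i. if i \<in> fst (d ! h) then 1 else 0 :: real"
  have 1: "(\<Sum>i<v. ?a h i) = real k1" if "h < r" for h
    using replicate_blocks[OF that] by (simp add: sum.If_cases Int_absorb1)
  have "(\<Sum>i<v. ?a h i * ?a h' i) = (\<Sum>i<v. if i \<in> fst (d ! h) \<inter> fst (d ! h') then 1 else 0)"
    by (rule sum.cong) auto
  also have "\<dots> = real (concurrence d h h')"
  proof -
    have "{..<v} \<inter> (fst (d ! h) \<inter> fst (d ! h')) = fst (d ! h) \<inter> fst (d ! h')"
      using replicate_blocks(1)[OF h] by auto
    then show ?thesis
      by (subst sum.If_cases) (simp_all only: finite_lessThan Collect_mem_eq concurrence_def, simp)
  qed
  finally have 2: "(\<Sum>i<v. ?a h i * ?a h' i) = real (concurrence d h h')" .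
  have "(\<Sum>i<v. w h i * w h' i) = (\<Sum>i<v. (real v)\<^sup>2 * (?a h i * ?a h' i)
      - real v * real k1 * ?a h i - real v * real k1 * ?a h' i + (real k1)\<^sup>2)"
    by (rule sum.cong) (auto simp: contrast_def v power2_eq_square algebra_simps)
  also have "\<dots> = (real v)\<^sup>2 * real (concurrence d h h') - real v * (real k1)\<^sup>2"
    unfolding sum.distrib sum_subtractf sum_distrib_left[symmetric] 1[OF h] 1[OF h'] 2
    by (simp add: power2_eq_square)
  also have "\<dots> = \<kappa> * gram k1 k2 d $$ (h, h')"
    using k h h' length_design by (simp add: gram_def v[symmetric] power2_eq_square field_simps)
  finally show ?thesis .
qed

lemma gram_carrier: "gram k1 k2 d \<in> carrier_mat r r"
  by (simp add: gram_def length_design)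

lemma gram_sym: "h < r \<Longrightarrow> h' < r \<Longrightarrow> gram k1 k2 d $$ (h, h') = gram k1 k2 d $$ (h', h)"
  by (simp add: gram_def length_design concurrence_def Int_commute)

lemma gram_diag: "h < r \<Longrightarrow> gram k1 k2 d $$ (h, h) = 1"
proof -
  have "real k1 - (real k1)\<^sup>2 / real (k1 + k2) = real k1 * real k2 / real (k1 + k2)"
    using k by (simp add: divide_simps power2_eq_square) (simp add: algebra_simps)
  then show "gram k1 k2 d $$ (h, h) = 1" if "h < r"
    using that k by (simp add: gram_def length_design concurrence_self del: of_nat_add)
qed

text \<open>
  Averaging over the blocks of one replicate is the orthogonal projection onto the span of the two
  block indicators. An orthogonal basis of that plane consists of the all-ones vector and the
  contrast, with squared lengths \<open>v\<close> and \<open>k1 k2 v\<close>.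
\<close>

lemma projection_entry:
  assumes "h < r" "i < v" "j < v"
  shows "(if i \<in> fst (d ! h) \<and> j \<in> fst (d ! h) then 1 / real k1 else 0)
      + (if i \<in> snd (d ! h) \<and> j \<in> snd (d ! h) then 1 / real k2 else 0)
    = 1 / real v + w h i * w h j / \<kappa>"
  using assms k unfolding replicate_blocks(3)[OF assms(1)]
  by (auto simp: contrast_def v divide_simps) (auto simp: algebra_simps)

lemma information_matrix_carrier: "information_matrix v k1 k2 d \<in> carrier_mat v v"
  by (auto simp: information_matrix_def incidence_matrix_def block_size_matrix_inverse[OF k] intro!: minus_carrier_mat)

lemma information_matrix_entry:
  assumes i: "i < v" and j: "j < v"
  shows "information_matrix v k1 k2 d $$ (i, j)
    = (if i = j then real r else 0) - (\<Sum>h<r. 1 / real v + w h i * w h j / \<kappa>)"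
proof -
  let ?N = "incidence_matrix v d"
  let ?E = "mat_diag (2 * r) (\<lambda>b. if even b then 1 / real k1 else 1 / real k2)"
  have N: "?N \<in> carrier_mat v (2 * r)" by (simp add: incidence_matrix_def length_design)
  have NE: "?N * ?E = mat v (2 * r) (\<lambda>(i, b). ?N $$ (i, b) * (if even b then 1 / real k1 else 1 / real k2))"
    by (rule mat_diag_mult_right[OF N])
  have "(?N * ?E * transpose_mat ?N) $$ (i, j)
      = (\<Sum>b<2 * r. ?N $$ (i, b) * (if even b then 1 / real k1 else 1 / real k2) * ?N $$ (j, b))"
    using N i j unfolding NE by (simp add: scalar_prod_def atLeast0LessThan)
  also have "\<dots> = (\<Sum>h<r. (if i \<in> fst (d ! h) \<and> j \<in> fst (d ! h) then 1 / real k1 else 0)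
      + (if i \<in> snd (d ! h) \<and> j \<in> snd (d ! h) then 1 / real k2 else 0))"
    unfolding sum_pairs using i j by (intro sum.cong) (auto simp: incidence_matrix_def length_design block_def)
  also have "\<dots> = (\<Sum>h<r. 1 / real v + w h i * w h j / \<kappa>)"
    using i j by (intro sum.cong projection_entry) auto
  finally show ?thesis
    using i j N by (simp add: information_matrix_def block_size_matrix_inverse[OF k] length_design)
qed

lemma trace_information_matrix: "trace (information_matrix v k1 k2 d) = real r * (real v - 2)"
proof -
  have v0: "real v > 0" using k v by simp
  have "trace (information_matrix v k1 k2 d)
      = (\<Sum>i<v. real r - (\<Sum>h<r. 1 / real v + w h i * w h i / \<kappa>))"
    using information_matrix_carrier by (simp add: trace_def information_matrix_entry)
  also have "\<dots> = real v * real r - (\<Sum>h<r. \<Sum>i<v. 1 / real v + w h i * w h i / \<kappa>)"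
    unfolding sum_subtractf by (subst sum.swap) simp
  also have "(\<Sum>h<r. \<Sum>i<v. 1 / real v + w h i * w h i / \<kappa>) = (\<Sum>h<r. 2)"
  proof (rule sum.cong[OF refl])
    fix h assume "h \<in> {..<r}"
    then show "(\<Sum>i<v. 1 / real v + w h i * w h i / \<kappa>) = 2"
      using k v0 unfolding sum.distrib sum_divide_distrib[symmetric]
      by (simp add: contrast_inner gram_diag)
  qed
  finally show ?thesis by (simp add: algebra_simps)
qed

text \<open>
  By \<open>information_matrix_entry\<close> the information matrix is \<open>r I - X Y\<close>, where \<open>X\<close> has the all-ones
  vector and the \<open>r\<close> contrasts as columns and \<open>Y\<close> is its suitably rescaled transpose. In the other
  order, \<open>Y X\<close> is block diagonal with blocks \<open>r\<close> and the Gram matrix, because contrasts are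
  orthogonal to the all-ones vector. So the spectrum consists of \<open>0\<close>, of \<open>r - \<mu>\<close> for the
  eigenvalues \<open>\<mu>\<close> of the Gram matrix, and of \<open>v - 1 - r\<close> copies of \<open>r\<close>.
\<close>

lemma char_poly_information_matrix:
  assumes rv: "r + 1 \<le> v" and es: "char_poly (gram k1 k2 d) = (\<Prod>\<mu>\<leftarrow>es. [:- \<mu>, 1:])"
  shows "char_poly (information_matrix v k1 k2 d)
    = (\<Prod>a\<leftarrow>0 # replicate (v - 1 - r) (real r) @ map (\<lambda>\<mu>. real r - \<mu>) es. [:- a, 1:])"
proof -
  define X where "X = mat v (1 + r) (\<lambda>(i, b). if b = 0 then 1 else w (b - 1) i)"
  define Y where "Y = mat (1 + r) v (\<lambda>(b, i). if b = 0 then real r / real v else w (b - 1) i / \<kappa>)"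
  have X: "X \<in> carrier_mat v (1 + r)" and Y: "Y \<in> carrier_mat (1 + r) v"
    by (simp_all add: X_def Y_def)
  have v0: "real v > 0" using k v by simp
  have XY: "(X * Y) $$ (i, j) = (\<Sum>h<r. 1 / real v + w h i * w h j / \<kappa>)" if "i < v" "j < v" for i j
  proof -
    have "(X * Y) $$ (i, j) = (\<Sum>b<Suc r. X $$ (i, b) * Y $$ (b, j))"
      using X Y that by (simp add: scalar_prod_def atLeast0LessThan)
    also have "\<dots> = real r / real v + (\<Sum>h<r. w h i * w h j / \<kappa>)"
      unfolding sum.lessThan_Suc_shift using that by (simp add: X_def Y_def)
    finally show ?thesis by (simp add: sum.distrib)
  qed
  have inf: "information_matrix v k1 k2 d = real r \<cdot>\<^sub>m 1\<^sub>m v - X * Y"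
    using information_matrix_carrier X Y
    by (intro eq_matI) (auto simp: information_matrix_entry XY simp del: index_mult_mat(1))
  have YX: "Y * X = four_block_mat (mat 1 1 (\<lambda>_. real r)) (0\<^sub>m 1 r) (0\<^sub>m r 1) (gram k1 k2 d)"
  proof (rule eq_matI)
    fix a b
    assume "a < dim_row (four_block_mat (mat 1 1 (\<lambda>_. real r)) (0\<^sub>m 1 r) (0\<^sub>m r 1) (gram k1 k2 d))"
      "b < dim_col (four_block_mat (mat 1 1 (\<lambda>_. real r)) (0\<^sub>m 1 r) (0\<^sub>m r 1) (gram k1 k2 d))"
    then have ab: "a < Suc r" "b < Suc r" using gram_carrier by auto
    have "(Y * X) $$ (a, b) = (\<Sum>i<v. Y $$ (a, i) * X $$ (i, b))"
      using X Y ab by (simp add: scalar_prod_def atLeast0LessThan)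
    also have "\<dots> = (if a = 0 then (if b = 0 then real r else 0) else
        if b = 0 then 0 else gram k1 k2 d $$ (a - 1, b - 1))"
    proof -
      have "(\<Sum>i<v. real r / real v * w (b - 1) i) = 0" if "b \<noteq> 0"
        using contrast_sum[of "b - 1"] ab that by (simp only: sum_distrib_left[symmetric])
      moreover have "(\<Sum>i<v. w (a - 1) i / \<kappa>) = 0" if "a \<noteq> 0"
        using contrast_sum[of "a - 1"] ab that by (simp add: sum_divide_distrib[symmetric])
      moreover have "(\<Sum>i<v. w (a - 1) i / \<kappa> * w (b - 1) i) = gram k1 k2 d $$ (a - 1, b - 1)"
        if "a \<noteq> 0" "b \<noteq> 0"
        using contrast_inner[of "a - 1" "b - 1"] ab that k v0
        by (simp add: sum_divide_distrib[symmetric])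
      ultimately show ?thesis using ab v0 by (simp add: X_def Y_def)
    qed
    finally show "(Y * X) $$ (a, b)
        = four_block_mat (mat 1 1 (\<lambda>_. real r)) (0\<^sub>m 1 r) (0\<^sub>m r 1) (gram k1 k2 d) $$ (a, b)"
      using ab gram_carrier by simp
  qed (use X Y gram_carrier in auto)
  have "char_poly (mat 1 1 (\<lambda>_. real r)) = [:- real r, 1:]"
    by (subst char_poly_upper_triangular[of _ 1]) (auto simp: diag_mat_def)
  then have "char_poly (Y * X) = (\<Prod>a\<leftarrow>real r # es. [:- a, 1:])"
    using gram_carrier es unfolding YX
    by (subst char_poly_four_block_zeros_col[of _ _ r]) auto
  moreover have "monom 1 m = (\<Prod>a\<leftarrow>replicate m 0. [:- a, 1:] :: real poly)" for m
    by (simp add: prod_list_replicate monom_altdef)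
  ultimately have "char_poly (X * Y) = (\<Prod>a\<leftarrow>replicate (v - 1 - r) 0 @ real r # es. [:- a, 1:])"
    using char_poly_mult_comm[OF X Y] rv by simp
  from char_poly_scalar_minus[OF _ this, of v "real r"] X Y
  have "char_poly (information_matrix v k1 k2 d)
      = (\<Prod>a\<leftarrow>replicate (v - 1 - r) 0 @ real r # es. [:- (real r - a), 1:])"
    unfolding inf by simp
  also have "\<dots> = (\<Prod>a\<leftarrow>0 # replicate (v - 1 - r) (real r) @ map (\<lambda>\<mu>. real r - \<mu>) es. [:- a, 1:])"
    by (simp add: comp_def mult_ac)
  finally show ?thesis .
qed

lemma gram_eigenvector:
  assumes "eigenvalue (gram k1 k2 d) \<mu>"
  shows "\<exists>y. (\<forall>h<r. (\<Sum>h'<r. gram k1 k2 d $$ (h, h') * y h') = \<mu> * y h) \<and> (\<exists>h<r. y h \<noteq> 0)"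
proof -
  obtain x where x: "x \<in> carrier_vec r" "x \<noteq> 0\<^sub>v r" "gram k1 k2 d *\<^sub>v x = \<mu> \<cdot>\<^sub>v x"
    using assms gram_carrier by (auto simp: eigenvalue_def eigenvector_def)
  obtain h where "h < r" "x $ h \<noteq> 0" using x(1,2) by (metis carrier_vecD eq_vecI index_zero_vec)
  moreover have "(\<Sum>h'<r. gram k1 k2 d $$ (h, h') * x $ h') = \<mu> * x $ h" if "h < r" for h
    using arg_cong[OF x(3), of "\<lambda>y. y $ h"] that gram_carrier x(1)
    by (simp add: scalar_prod_def atLeast0LessThan)
  ultimately show ?thesis by (intro exI[of _ "\<lambda>h. x $ h"]) auto
qed

lemma contrast_inner_combination:
  assumes "h < r"
  shows "(\<Sum>i<v. w h i * (\<Sum>h'<r. y h' * w h' i)) = \<kappa> * (\<Sum>h'<r. gram k1 k2 d $$ (h, h') * y h')"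
proof -
  have "(\<Sum>i<v. w h i * (\<Sum>h'<r. y h' * w h' i)) = (\<Sum>h'<r. y h' * (\<Sum>i<v. w h i * w h' i))"
    unfolding sum_distrib_left by (subst sum.swap) (simp add: mult_ac)
  also have "\<dots> = (\<Sum>h'<r. y h' * (\<kappa> * gram k1 k2 d $$ (h, h')))"
    using assms by (simp add: contrast_inner)
  finally show ?thesis by (simp add: sum_distrib_left mult_ac)
qed

lemma gram_eigenvalue_nonneg:
  assumes "eigenvalue (gram k1 k2 d) \<mu>"
  shows "0 \<le> \<mu>"
proof -
  obtain y h where y: "\<And>h. h < r \<Longrightarrow> (\<Sum>h'<r. gram k1 k2 d $$ (h, h') * y h') = \<mu> * y h"
    and h: "h < r" "y h \<noteq> 0" using gram_eigenvector[OF assms] by blast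
  have "0 \<le> (\<Sum>i<v. (\<Sum>h<r. y h * w h i)\<^sup>2)" by (simp add: sum_nonneg)
  also have "\<dots> = (\<Sum>h<r. y h * (\<Sum>i<v. w h i * (\<Sum>h'<r. y h' * w h' i)))"
    unfolding power2_eq_square sum_distrib_right
    by (subst sum.swap) (simp add: sum_distrib_left mult_ac)
  also have "\<dots> = (\<Sum>h<r. y h * (\<kappa> * (\<mu> * y h)))"
    by (simp add: contrast_inner_combination y)
  also have "\<dots> = \<kappa> * \<mu> * (\<Sum>h<r. (y h)\<^sup>2)"
    by (simp add: sum_distrib_left power2_eq_square mult_ac)
  finally have "0 \<le> \<kappa> * \<mu> * (\<Sum>h<r. (y h)\<^sup>2)" .
  then have "0 \<le> \<mu> * (\<kappa> * (\<Sum>h<r. (y h)\<^sup>2))" by (simp only: mult_ac)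
  moreover have "0 < \<kappa> * (\<Sum>h<r. (y h)\<^sup>2)"
  proof (rule mult_pos_pos)
    show "0 < (\<Sum>h<r. (y h)\<^sup>2)" using h by (intro sum_pos2[of _ h]) auto
  qed (use k v in simp)
  ultimately show ?thesis by (meson mult_neg_pos not_le)
qed

text \<open>
  An eigenvector \<open>y\<close> of the Gram matrix for \<open>r\<close> yields the combination \<open>u\<close> of contrasts with
  coefficients \<open>y\<close>. It is nonzero, orthogonal to the all-ones vector, and annihilated by the
  information matrix, which also annihilates constant vectors. A kernel of dimension two contradicts
  connectedness. In this way connectedness, a condition on the rank, makes the algebraic multiplicity
  of the eigenvalue \<open>0\<close> equal to one.
\<close>

lemma connected_imp_not_gram_eigenvalue:
  assumes conn: "connected_design v k1 k2 d"
  shows "\<not> eigenvalue (gram k1 k2 d) (real r)"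
proof
  assume "eigenvalue (gram k1 k2 d) (real r)"
  then obtain y h where y: "\<And>h. h < r \<Longrightarrow> (\<Sum>h'<r. gram k1 k2 d $$ (h, h') * y h') = real r * y h"
    and h: "h < r" "y h \<noteq> 0" using gram_eigenvector by blast
  have v0: "real v > 0" using k v by simp
  define u where "u i = (\<Sum>h<r. y h * w h i)" for i
  have wu: "(\<Sum>i<v. w h i * u i) = \<kappa> * real r * y h" if "h < r" for h
    using that by (simp add: u_def contrast_inner_combination y)
  have su: "(\<Sum>i<v. u i) = 0"
    unfolding u_def by (subst sum.swap) (simp add: sum_distrib_left[symmetric] contrast_sum)
  have "vec_space.rank v (information_matrix v k1 k2 d) < v - 1"
  proof (rule kernel_meets_hyperplanes_low_rank[OF information_matrix_carrier])
    fix j assume j: "j < v"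
    \<comment> \<open>subtracting a constant from \<open>u\<close> moves the kernel vector into the hyperplane \<open>x $ j = 0\<close>\<close>
    let ?x = "vec v (\<lambda>i. u i - u j)"
    have "?x \<noteq> 0\<^sub>v v"
    proof
      assume 0: "?x = 0\<^sub>v v"
      have const: "u i = u j" if "i < v" for i
        using arg_cong[OF 0, of "\<lambda>x. x $ i"] that by simp
      then have "real v * u j = 0" using su by simp
      then have "u i = 0" if "i < v" for i using const[OF that] v0 by simp
      then have "\<kappa> * real r * y h = 0" using wu[OF h(1)] by simp
      then show False using k h v0 by auto
    qed
    moreover have "information_matrix v k1 k2 d *\<^sub>v ?x = 0\<^sub>v v"
    proof (rule eq_vecI)
      fix i assume "i < dim_vec (0\<^sub>v v :: real vec)"
      then have i: "i < v" by simp
      have wx: "(\<Sum>l<v. w h l * (u l - u j)) = \<kappa> * real r * y h" if "h < r" for h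
        using wu[OF that] contrast_sum[OF that]
        by (simp add: right_diff_distrib sum_subtractf sum_distrib_right[symmetric])
      have "(information_matrix v k1 k2 d *\<^sub>v ?x) $ i
          = (\<Sum>l<v. ((if i = l then real r else 0) - (\<Sum>h<r. 1 / real v + w h i * w h l / \<kappa>)) * (u l - u j))"
        using i information_matrix_carrier
        by (simp add: scalar_prod_def atLeast0LessThan information_matrix_entry)
      also have "\<dots> = (\<Sum>l<v. (if i = l then real r * (u l - u j) else 0))
          - (\<Sum>l<v. \<Sum>h<r. (1 / real v) * (u l - u j) + w h i / \<kappa> * (w h l * (u l - u j)))"
      proof -
        have "(\<Sum>h<r. 1 / real v + w h i * w h l / \<kappa>) * t
            = (\<Sum>h<r. (1 / real v) * t + w h i / \<kappa> * (w h l * t))" for l t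
          unfolding sum_distrib_right by (simp add: algebra_simps)
        then show ?thesis
          unfolding sum_subtractf[symmetric] left_diff_distrib by (intro sum.cong) auto
      qed
      also have "(\<Sum>l<v. \<Sum>h<r. (1 / real v) * (u l - u j) + w h i / \<kappa> * (w h l * (u l - u j)))
          = (\<Sum>h<r. (1 / real v) * (\<Sum>l<v. u l - u j) + w h i / \<kappa> * (\<Sum>l<v. w h l * (u l - u j)))"
        by (subst sum.swap) (simp add: sum.distrib sum_distrib_left)
      also have "\<dots> = (\<Sum>h<r. - u j + real r * (y h * w h i))"
        using k v0 by (intro sum.cong) (simp_all add: wx sum_subtractf su)
      also have "\<dots> = real r * (u i - u j)"
        by (simp add: sum.distrib u_def sum_distrib_left sum_subtractf algebra_simps)
      finally show "(information_matrix v k1 k2 d *\<^sub>v ?x) $ i = 0\<^sub>v v $ i" using i by simp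
    qed (use information_matrix_carrier in simp)
    ultimately show "\<exists>x\<in>carrier_vec v. x \<noteq> 0\<^sub>v v \<and> information_matrix v k1 k2 d *\<^sub>v x = 0\<^sub>v v \<and> x $ j = 0"
      using j by (intro bexI[of _ ?x]) auto
  qed (use k v in simp)
  then show False using conn by (simp add: connected_design_def)
qed

text \<open>
  Only the \<open>r\<close> eigenvalues \<open>z i\<close> vary with the design. Their sum is fixed because the Gram matrix has
  unit diagonal, and their squared deviations from the mean \<open>r - 1\<close> add up to the sum of the squared
  off-diagonal entries of the Gram matrix. The bounds \<open>0 < z i \<le> r\<close> hold because the eigenvalues of
  the Gram matrix are nonnegative with sum \<open>r\<close> and, by connectedness, different from \<open>r\<close>.
\<close>

lemma connected_spectrum:
  assumes conn: "connected_design v k1 k2 d" and rv: "r + 1 \<le> v" and r: "0 < r"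
  shows "\<exists>z. (\<forall>i<r. 0 < z i \<and> z i \<le> real r \<and> eigenvalue (gram k1 k2 d) (real r - z i))
    \<and> (\<Sum>i<r. z i) = real r * (real r - 1)
    \<and> (\<Sum>i<r. (z i - (real r - 1))\<^sup>2)
        = (\<Sum>h<r. \<Sum>h'\<in>{..<r} - {h}. (gram k1 k2 d $$ (h, h'))\<^sup>2)
    \<and> mset (nonzero_eigvals v k1 k2 d) = replicate_mset (v - 1 - r) (real r) + mset (map z [0..<r])"
proof -
  note G = gram_carrier
  obtain es where es: "char_poly (gram k1 k2 d) = (\<Prod>\<mu>\<leftarrow>es. [:- \<mu>, 1:])"
    using symmetric_char_poly_splits[OF G gram_sym] .
  note mom = eigenvalue_moments[OF G es]
  define z where "z i = real r - es ! i" for i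
  have ev: "eigenvalue (gram k1 k2 d) (es ! i)" if "i < r" for i
  proof -
    have "es ! i \<in> set es" using that mom(1) by simp
    then have "poly (char_poly (gram k1 k2 d)) (es ! i) = 0"
      unfolding es by (auto simp: poly_prod_list prod_list_zero_iff)
    then show ?thesis using eigenvalue_root_char_poly[OF G] by simp
  qed
  have s1: "(\<Sum>i<r. es ! i) = real r"
    using G by (simp add: mom(2) trace_def gram_diag)
  have s2: "(\<Sum>i<r. (es ! i)\<^sup>2) = real r + (\<Sum>h<r. \<Sum>h'\<in>{..<r} - {h}. (gram k1 k2 d $$ (h, h'))\<^sup>2)"
  proof -
    have "(\<Sum>i<r. (es ! i)\<^sup>2) = (\<Sum>h<r. \<Sum>h'<r. gram k1 k2 d $$ (h, h') * gram k1 k2 d $$ (h', h))"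
      using G by (simp add: mom(3) trace_def scalar_prod_def atLeast0LessThan)
    also have "\<dots> = (\<Sum>h<r. 1 + (\<Sum>h'\<in>{..<r} - {h}. (gram k1 k2 d $$ (h, h'))\<^sup>2))"
    proof (rule sum.cong[OF refl])
      fix h assume h: "h \<in> {..<r}"
      have "(\<Sum>h'<r. gram k1 k2 d $$ (h, h') * gram k1 k2 d $$ (h', h))
          = (\<Sum>h'<r. (gram k1 k2 d $$ (h, h'))\<^sup>2)"
        using h gram_sym by (intro sum.cong) (auto simp: power2_eq_square)
      also have "\<dots> = 1 + (\<Sum>h'\<in>{..<r} - {h}. (gram k1 k2 d $$ (h, h'))\<^sup>2)"
        using h by (subst sum.remove[of _ h]) (simp_all add: gram_diag)
      finally show "(\<Sum>h'<r. gram k1 k2 d $$ (h, h') * gram k1 k2 d $$ (h', h))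
          = 1 + (\<Sum>h'\<in>{..<r} - {h}. (gram k1 k2 d $$ (h, h'))\<^sup>2)" .
    qed
    finally show ?thesis by (simp add: sum.distrib)
  qed
  have es0: "0 \<le> es ! i" if "i < r" for i using gram_eigenvalue_nonneg ev that by blast
  have esr: "es ! i < real r" if i: "i < r" for i
  proof -
    have "es ! i \<le> real r"
      unfolding s1[symmetric] using i es0 by (intro member_le_sum) auto
    moreover have "es ! i \<noteq> real r" using connected_imp_not_gram_eigenvalue[OF conn] ev[OF i] by metis
    ultimately show ?thesis by simp
  qed
  have map: "map (\<lambda>\<mu>. real r - \<mu>) es = map z [0..<r]"
    using mom(1) by (intro nth_equalityI) (auto simp: z_def)
  have pr: "proots (char_poly (information_matrix v k1 k2 d))
      = add_mset 0 (replicate_mset (v - 1 - r) (real r) + mset (map z [0..<r]))"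
    unfolding char_poly_information_matrix[OF rv es] proots_linear_factors map by simp
  have "filter_mset (\<lambda>x. x \<noteq> 0) (mset (map z [0..<r])) = mset (map z [0..<r])"
  proof -
    have "z i \<noteq> 0" if "i < r" for i using esr[OF that] by (simp add: z_def)
    then show ?thesis by (auto simp: filter_mset_eq_conv)
  qed
  moreover have "filter_mset (\<lambda>x. x \<noteq> 0) (replicate_mset m (real r)) = replicate_mset m (real r)" for m
    using r by (auto simp: filter_mset_eq_conv)
  ultimately have "mset (nonzero_eigvals v k1 k2 d)
      = replicate_mset (v - 1 - r) (real r) + mset (map z [0..<r])"
    unfolding nonzero_eigvals_def pr mset_sorted_list_of_multiset by simp
  moreover have "(\<Sum>i<r. z i) = real r * (real r - 1)"
    by (simp add: z_def sum_subtractf s1 algebra_simps)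
  moreover have "(\<Sum>i<r. (z i - (real r - 1))\<^sup>2) = (\<Sum>i<r. (es ! i)\<^sup>2 - 2 * es ! i + 1)"
    by (rule sum.cong) (auto simp: z_def power2_eq_square algebra_simps)
  then have "(\<Sum>i<r. (z i - (real r - 1))\<^sup>2) = (\<Sum>h<r. \<Sum>h'\<in>{..<r} - {h}. (gram k1 k2 d $$ (h, h'))\<^sup>2)"
    by (simp add: sum.distrib sum_subtractf s2 sum_distrib_left[symmetric] s1)
  moreover have "\<forall>i<r. 0 < z i \<and> z i \<le> real r \<and> eigenvalue (gram k1 k2 d) (real r - z i)"
    using ev esr es0 by (simp add: z_def)
  ultimately show ?thesis by blast
qed

end

section \<open>Criteria and equal concurrence designs\<close>

lemma type1_criterion_split:
  assumes "mset (nonzero_eigvals v k1 k2 d) = replicate_mset m (real r) + mset (map z [0..<r])"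
    and "v - 1 = m + r"
  shows "type1_criterion v k1 k2 f d = real m * f (real r) + (\<Sum>i<r. f (z i))"
proof -
  let ?l = "nonzero_eigvals v k1 k2 d"
  have "length ?l = v - 1" using arg_cong[OF assms(1), of size] assms(2) by simp
  have "type1_criterion v k1 k2 f d = (\<Sum>i<v - 1. f (?l ! i))"
    unfolding type1_criterion_def eigval_def
    by (rule sum.reindex_bij_witness[of _ Suc "\<lambda>i. i - 1"]) auto
  also have "\<dots> = sum_list (map f ?l)"
    using \<open>length ?l = v - 1\<close> by (simp add: sum_list_sum_nth atLeast0LessThan)
  also have "\<dots> = sum_mset (image_mset f (mset ?l))" by (simp add: sum_mset_sum_list[symmetric])
  also have "\<dots> = real m * f (real r) + sum_list (map (\<lambda>i. f (z i)) [0..<r])"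
    unfolding assms(1) by (simp add: sum_mset_sum_list[symmetric] comp_def image_mset.compositionality)
  finally show ?thesis by (simp add: interv_sum_list_conv_sum_set_nat atLeast0LessThan)
qed

lemma eigval_1_le:
  assumes "x \<in># mset (nonzero_eigvals v k1 k2 d)"
  shows "eigval v k1 k2 d 1 \<le> x"
proof -
  have "sorted (nonzero_eigvals v k1 k2 d)" by (simp add: nonzero_eigvals_def)
  moreover obtain i where "i < length (nonzero_eigvals v k1 k2 d)" "nonzero_eigvals v k1 k2 d ! i = x"
    using assms by (auto simp: in_set_conv_nth)
  ultimately show ?thesis unfolding eigval_def by (auto dest: sorted_nth_mono[of _ 0 i])
qed

lemma eigval_1_mem:
  assumes "nonzero_eigvals v k1 k2 d \<noteq> []"
  shows "eigval v k1 k2 d 1 \<in># mset (nonzero_eigvals v k1 k2 d)"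
  using assms by (simp add: eigval_def)

lemma max_trace_eq:
  assumes "d \<in> design_class v r k1 k2" "0 < k1" "0 < k2" "v = k1 + k2"
  shows "max_trace v r k1 k2 = real r * (real v - 2)"
proof -
  have "(\<lambda>d. trace (information_matrix v k1 k2 d)) ` design_class v r k1 k2 = {real r * (real v - 2)}"
  proof -
    have "trace (information_matrix v k1 k2 e) = real r * (real v - 2)"
      if "e \<in> design_class v r k1 k2" for e
      using that assms(2-) by (intro trace_information_matrix) (auto simp: design_class_def)
    then show ?thesis using assms(1) by force
  qed
  then show ?thesis by (simp add: max_trace_def)
qed

text \<open>
  The concurrences are integers, and \<open>gamma \<le> 1 / 2\<close> says that \<open>theta_bar\<close> is an integer nearest to
  \<open>k1\<^sup>2 / (k1 + k2)\<close>.
\<close>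

lemma off_diagonal_bound:
  assumes res: "resolvable_design v r k1 k2 d" and k: "0 < k1" "0 < k2"
    and h: "h < r" "h' < r" and \<gamma>: "0 \<le> gamma k1 k2" "gamma k1 k2 \<le> 1 / 2"
  shows "(real (k1 + k2) / (real k1 * real k2) * gamma k1 k2)\<^sup>2 \<le> (gram k1 k2 d $$ (h, h'))\<^sup>2"
proof -
  have l: "length d = r" using res by (simp add: resolvable_design_def)
  define n where "n = int (concurrence d h h') - theta_bar k1 k2"
  have g: "gram k1 k2 d $$ (h, h') = real (k1 + k2) / (real k1 * real k2) * (of_int n - gamma k1 k2)"
    using h l by (simp add: gram_def n_def gamma_def)
  have "gamma k1 k2 \<le> \<bar>of_int n - gamma k1 k2\<bar>"
  proof (cases "n \<le> 0")
    case True
    then have "(of_int n :: real) \<le> 0" by simp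
    then show ?thesis by linarith
  next
    case False
    then have "(1 :: real) \<le> of_int n" by simp
    then show ?thesis using \<gamma> by linarith
  qed
  then have "(gamma k1 k2)\<^sup>2 \<le> (of_int n - gamma k1 k2)\<^sup>2" using \<gamma> by (metis abs_le_square_iff abs_of_nonneg)
  then show ?thesis unfolding g power_mult_distrib by (intro mult_left_mono) auto
qed

text \<open>
  All off-diagonal entries of the Gram matrix equal \<open>-g\<close>, so it is \<open>(1 + g) I - g J\<close> with the
  all-ones matrix \<open>J\<close>.
\<close>

lemma ECD_gram_eigenvalue:
  assumes res: "resolvable_design v r k1 k2 d" and k: "0 < k1" "0 < k2" "v = k1 + k2"
    and ecd: "ECD (theta_bar k1 k2) d"
    and g: "g = real (k1 + k2) / (real k1 * real k2) * gamma k1 k2"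
    and ev: "eigenvalue (gram k1 k2 d) \<mu>"
  shows "\<mu> = 1 + g \<or> \<mu> = 1 - (real r - 1) * g"
proof -
  have l: "length d = r" using res by (simp add: resolvable_design_def)
  obtain y h where y: "\<And>h. h < r \<Longrightarrow> (\<Sum>h'<r. gram k1 k2 d $$ (h, h') * y h') = \<mu> * y h"
    and h: "h < r" "y h \<noteq> 0" using gram_eigenvector[OF res k ev] by blast
  have G: "gram k1 k2 d $$ (h, h') = (if h' = h then 1 + g else 0) - g" if "h < r" "h' < r" for h h'
  proof (cases "h' = h")
    case True
    then show ?thesis using gram_diag[OF res k] that by simp
  next
    case False
    then have "real (concurrence d h h') = of_int (theta_bar k1 k2)"
      using ecd that l by (metis ECD_def of_int_of_nat_eq)
    then show ?thesis using False that l by (simp add: gram_def g gamma_def algebra_simps)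
  qed
  define s where "s = (\<Sum>h<r. y h)"
  have eq: "(1 + g - \<mu>) * y h = g * s" if "h < r" for h
  proof -
    have "\<mu> * y h = (\<Sum>h'<r. (if h' = h then (1 + g) * y h' else 0) - g * y h')"
      unfolding y[OF that, symmetric] using that by (intro sum.cong) (auto simp: G algebra_simps)
    also have "\<dots> = (1 + g) * y h - g * s"
      using that by (simp add: sum_subtractf s_def sum_distrib_left)
    finally show ?thesis by (simp add: algebra_simps)
  qed
  show ?thesis
  proof (cases "s = 0")
    case True
    then show ?thesis using eq[OF h(1)] h by simp
  next
    case False
    have "(1 + g - \<mu>) * s = (\<Sum>h<r. (1 + g - \<mu>) * y h)" by (simp add: s_def sum_distrib_left)
    also have "\<dots> = (\<Sum>h<r. g * s)" by (intro sum.cong) (auto simp: eq)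
    finally have "(1 + g - \<mu>) * s = real r * g * s" by simp
    then have "1 + g - \<mu> = real r * g" using False by simp
    then show ?thesis by (simp add: algebra_simps)
  qed
qed

text \<open>
  For \<open>g \<noteq> 0\<close> the fixed sum determines how often each of the two values is taken:
  \<open>q = c + (r - 1) g\<close> once and \<open>c - g\<close> otherwise. The function \<open>t\<close> in the proof is the indicator of the value \<open>q\<close>.
\<close>

lemma two_point_sum:
  fixes z :: "'i \<Rightarrow> real"
  assumes I: "finite I" "card I = r" "0 < r"
    and z: "\<And>i. i \<in> I \<Longrightarrow> z i = c - g \<or> z i = c + (real r - 1) * g"
    and sum: "(\<Sum>i\<in>I. z i) = real r * c"
  shows "(\<Sum>i\<in>I. f (z i)) = (real r - 1) * f (c - g) + f (c + (real r - 1) * g)"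
proof (cases "g = 0")
  case True
  then have "(\<Sum>i\<in>I. f (z i)) = (\<Sum>i\<in>I. f c)" using z by (intro sum.cong) auto
  then show ?thesis using True I by (simp add: algebra_simps)
next
  case False
  define t where "t i = (z i - (c - g)) / (real r * g)" for i
  have t: "t i = 0 \<and> z i = c - g \<or> t i = 1 \<and> z i = c + (real r - 1) * g" if "i \<in> I" for i
    using z[OF that] False I by (auto simp: t_def field_simps)
  have T: "(\<Sum>i\<in>I. t i) = 1"
    using False I sum by (simp add: t_def sum_divide_distrib[symmetric] sum_subtractf algebra_simps)
  have "(\<Sum>i\<in>I. f (z i)) = (\<Sum>i\<in>I. f (c - g) + t i * (f (c + (real r - 1) * g) - f (c - g)))"
  proof (rule sum.cong[OF refl])
    fix i assume "i \<in> I"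
    from t[OF this] show "f (z i) = f (c - g) + t i * (f (c + (real r - 1) * g) - f (c - g))"
      by (elim disjE conjE) (simp_all only:, simp_all)
  qed
  also have "\<dots> = real r * f (c - g) + (f (c + (real r - 1) * g) - f (c - g))"
    by (simp add: sum.distrib sum_distrib_right[symmetric] T I)
  finally show ?thesis by (simp add: algebra_simps)
qed

theorem theorem5:
  fixes v r k1 k2 :: nat
  assumes "k1 \<ge> k2" and "k2 \<ge> 2" and "v = k1 + k2"
    and "2 \<le> r" and "r \<le> v - 1"
    and "0 \<le> gamma k1 k2" and "gamma k1 k2 \<le> 1 / 2"
  shows "\<forall>d \<in> design_class v r k1 k2. ECD (theta_bar k1 k2) d \<longrightarrow>
           type1_optimal v r k1 k2 d \<and> E_optimal v r k1 k2 d"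
proof (intro ballI impI)
  fix d assume d: "d \<in> design_class v r k1 k2" and ecd: "ECD (theta_bar k1 k2) d"
  have k: "0 < k1" "0 < k2" and rv: "r + 1 \<le> v" and r0: "0 < r" and vr: "v - 1 = (v - 1 - r) + r"
    using assms by linarith+
  define g where "g = real (k1 + k2) / (real k1 * real k2) * gamma k1 k2"
  define c where "c = real r - 1"
  have g0: "0 \<le> g" using assms by (simp add: g_def)
  define M where "M = max_trace v r k1 k2"
  have M: "M = real r * (real v - 2)" unfolding M_def using max_trace_eq[OF d k assms(3)] .
  \<comment> \<open>every eigenvalue is at most \<open>r\<close>, so this puts all of them into the interval on which \<open>f\<close> is controlled\<close>
  have "real r * 1 < real r * (real v - 2)" using assms by (intro mult_strict_left_mono) auto
  then have rM: "real r < M" by (simp add: M)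
  have dr: "resolvable_design v r k1 k2 d" and dc: "connected_design v k1 k2 d"
    using d by (auto simp: design_class_def)
  obtain z where z: "\<forall>i<r. 0 < z i \<and> z i \<le> real r \<and> eigenvalue (gram k1 k2 d) (real r - z i)"
    "(\<Sum>i<r. z i) = real r * (real r - 1)"
    "mset (nonzero_eigvals v k1 k2 d) = replicate_mset (v - 1 - r) (real r) + mset (map z [0..<r])"
    using connected_spectrum[OF dr k assms(3) dc rv r0] by blast
  have z2: "z i = c - g \<or> z i = c + (real r - 1) * g" if "i < r" for i
    using ECD_gram_eigenvalue[OF dr k assms(3) ecd g_def _] z(1) that by (fastforce simp: c_def)
  have dsum: "(\<Sum>i<r. f (z i)) = (real r - 1) * f (c - g) + f (c + (real r - 1) * g)" for f :: "real \<Rightarrow> real"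
    by (rule two_point_sum) (use z2 z(2) r0 in \<open>auto simp: c_def\<close>)
  \<comment> \<open>both values occur among the eigenvalues: \<open>dsum\<close> for the indicator of the complement of the set of values gives a vanishing sum\<close>
  have pos: "0 < c - g" and small: "c + (real r - 1) * g < M"
  proof -
    have "(real r - 1) * (if c - g \<in> z ` {..<r} then 0 else 1)
        + (if c + (real r - 1) * g \<in> z ` {..<r} then 0 else (1::real)) = 0"
      unfolding dsum[of "\<lambda>x. if x \<in> z ` {..<r} then 0 else 1", symmetric] by (intro sum.neutral) auto
    moreover have "0 < real r - 1" using assms by simp
    ultimately have "c - g \<in> z ` {..<r}" "c + (real r - 1) * g \<in> z ` {..<r}"
      by (auto split: if_splits)
    then show "0 < c - g" "c + (real r - 1) * g < M" using z(1) rM by fastforce+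
  qed
  have competitor: "\<exists>x. (\<forall>i<r. 0 < x i \<and> x i \<le> real r) \<and> (\<Sum>i<r. x i) = real r * c
      \<and> real r * (real r - 1) * g\<^sup>2 \<le> (\<Sum>i<r. (x i - c)\<^sup>2)
      \<and> mset (nonzero_eigvals v k1 k2 e) = replicate_mset (v - 1 - r) (real r) + mset (map x [0..<r])"
    if e: "e \<in> design_class v r k1 k2" for e
  proof -
    have er: "resolvable_design v r k1 k2 e" and ec: "connected_design v k1 k2 e"
      using e by (auto simp: design_class_def)
    obtain x where x: "\<forall>i<r. 0 < x i \<and> x i \<le> real r \<and> eigenvalue (gram k1 k2 e) (real r - x i)"
      "(\<Sum>i<r. x i) = real r * (real r - 1)"
      "(\<Sum>i<r. (x i - (real r - 1))\<^sup>2) = (\<Sum>h<r. \<Sum>h'\<in>{..<r} - {h}. (gram k1 k2 e $$ (h, h'))\<^sup>2)"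
      "mset (nonzero_eigvals v k1 k2 e) = replicate_mset (v - 1 - r) (real r) + mset (map x [0..<r])"
      using connected_spectrum[OF er k assms(3) ec rv r0] by blast
    have "real r * (real r - 1) * g\<^sup>2 = (\<Sum>h<r. \<Sum>h'\<in>{..<r} - {h}. g\<^sup>2)"
      using r0 by (simp add: of_nat_diff)
    also have "\<dots> \<le> (\<Sum>h<r. \<Sum>h'\<in>{..<r} - {h}. (gram k1 k2 e $$ (h, h'))\<^sup>2)"
      unfolding g_def by (intro sum_mono off_diagonal_bound[OF er k]) (use assms in auto)
    finally show ?thesis using x by (intro exI[of _ x]) (auto simp: c_def)
  qed
  have "type1_optimal v r k1 k2 d"
    unfolding type1_optimal_def
  proof (intro conjI allI impI ballI d)
    fix f e assume f: "type1_function (max_trace v r k1 k2) f" and e: "e \<in> design_class v r k1 k2"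
    obtain x where x: "\<forall>i<r. 0 < x i \<and> x i \<le> real r" "(\<Sum>i<r. x i) = real r * c"
      "real r * (real r - 1) * g\<^sup>2 \<le> (\<Sum>i<r. (x i - c)\<^sup>2)"
      "mset (nonzero_eigvals v k1 k2 e) = replicate_mset (v - 1 - r) (real r) + mset (map x [0..<r])"
      using competitor[OF e] by blast
    obtain f' f'' f''' where f: "\<forall>x\<in>{0<..<M}. (f has_real_derivative f' x) (at x)
        \<and> (f' has_real_derivative f'' x) (at x) \<and> (f'' has_real_derivative f''' x) (at x)
        \<and> f' x < 0 \<and> f'' x > 0 \<and> f''' x < 0"
      using f unfolding type1_function_def M_def[symmetric] by blast
    have "(real r - 1) * f (c - g) + f (c + (real r - 1) * g) \<le> (\<Sum>i\<in>{..<r}. f (x i))"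
      by (rule type1_sum_bound[of M f f' f'' f''']) (use f x rM r0 g0 pos small in force)+
    then show "type1_criterion v k1 k2 f d \<le> type1_criterion v k1 k2 f e"
      unfolding type1_criterion_split[OF z(3) vr] type1_criterion_split[OF x(4) vr] dsum by simp
  qed
  moreover have "E_optimal v r k1 k2 d"
    unfolding E_optimal_def
  proof (intro conjI ballI d)
    fix e assume e: "e \<in> design_class v r k1 k2"
    obtain x where x: "(\<Sum>i<r. x i) = real r * c"
      "real r * (real r - 1) * g\<^sup>2 \<le> (\<Sum>i<r. (x i - c)\<^sup>2)"
      "mset (nonzero_eigvals v k1 k2 e) = replicate_mset (v - 1 - r) (real r) + mset (map x [0..<r])"
      using competitor[OF e] by blast
    obtain i where i: "i < r" "x i \<le> c - g"
      using exists_far_below_mean[of "{..<r}" r x c g] x assms by auto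
    have "eigval v k1 k2 e 1 \<le> x i" by (rule eigval_1_le) (use x(3) i in auto)
    also note i(2)
    also have "c - g \<le> eigval v k1 k2 d 1"
    proof -
      have "size (mset (nonzero_eigvals v k1 k2 d)) \<noteq> 0" unfolding z(3) using r0 by simp
      then have "eigval v k1 k2 d 1 \<in># mset (nonzero_eigvals v k1 k2 d)"
        by (intro eigval_1_mem) auto
      moreover have "c - g \<le> a" if "a \<in># mset (nonzero_eigvals v k1 k2 d)" for a
      proof -
        have "0 \<le> (real r - 1) * g" using g0 r0 by simp
        then have "c - g \<le> z i" if "i < r" for i using z2[OF that] g0 by auto
        then show ?thesis using that g0 unfolding z(3) by (auto simp: c_def split: if_splits)
      qed
      ultimately show ?thesis by blast
    qed
    finally show "eigval v k1 k2 e 1 \<le> eigval v k1 k2 d 1" .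
  qed
  ultimately show "type1_optimal v r k1 k2 d \<and> E_optimal v r k1 k2 d" by blast
qed

end
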